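(* Let $p$ be an odd prime and let $(\alpha,\beta)\in\mathbb{Q}_p^2$ have an infinite $p$-adic MCF expansion $[(a_0,a_1,\ldots),(b_0,b_1,\ldots)]$ such that \[\lim_{n\to\infty}\frac{k_n}{k_{n-1}+k_{n-2}}=\infty,\qquad\lim_{n\to\infty}\frac{h_n}{k_{n-1}}=\infty\] in $\mathbb{R}$. Then either $\alpha,\beta$ are algebraically independent over $\mathbb{Q}$, or there exists a non-zero polynomial $F(X,Y)\in\mathbb{Q}[X,Y]$ such that $F(Q_n^\alpha,Q_n^\beta)=0$ for all sufficiently large $n$.
   Context: $\nu_p$ denotes the $p$-adic valuation. Browkin's $s$-function $s:\mathbb{Q}_p\to\mathbb{Z}[1/p]\cap(-p/2,p/2)$ is $s(\alpha)=\sum_{j=k}^{0}x_jp^j$ where $\alpha=\sum_{j=k}^\infty x_jp^j$, $x_j\in\mathbb{Z}\cap(-p/2,p/2)$ (empty sum $=0$ if $k>0$). The $p$-adic Jacobi–Perron algorithm applied to $(\alpha,\beta)$: $\alpha_0=\alpha,\beta_0=\beta$, and for $k\geq0$: $a_k=s(\alpha_k)$, $b_k=s(\beta_k)$, and if $\beta_k\neq b_k$, $\alpha_{k+1}=1/(\beta_k-b_k)$, $\beta_{k+1}=(\alpha_k-a_k)/(\beta_k-b_k)$; if $\beta_k=b_k$ it stops. Define $A_{-2}=0,A_{-1}=1,A_0=a_0$; $B_{-2}=1,B_{-1}=0,B_0=b_0$; $C_{-2}=0,C_{-1}=0,C_0=1$, and for $n\geq1$: $X_n=a_nX_{n-1}+b_nX_{n-2}+X_{n-3}$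 for $X\in\{A,B,C\}$; $Q_n^\alpha=A_n/C_n$, $Q_n^\beta=B_n/C_n$. For $n\geq1$: $k_n=\nu_p(1/a_n)$, $h_n=\nu_p(b_n/a_n)$ ($=+\infty$ if $b_n=0$). *)

theory Defs
  imports
    "Berlekamp_Zassenhaus.Finite_Field"
    "HOL-Analysis.Analysis"
begin

section \<open>The \<open>p\<close>-adic valuation and absolute value on the rationals\<close>

definition rat_val :: "nat \<Rightarrow> rat \<Rightarrow> int" where
  "rat_val p q = int (multiplicity (int p) (fst (quotient_of q)))
               - int (multiplicity (int p) (snd (quotient_of q)))"

definition padic_val :: "nat \<Rightarrow> rat \<Rightarrow> ereal" where
  "padic_val p q = (if q = 0 then \<infinity> else ereal (of_int (rat_val p q)))"

definition pnorm :: "nat \<Rightarrow> rat \<Rightarrow> real" where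
  "pnorm p q = (if q = 0 then 0 else real p powi (- rat_val p q))"

context
  fixes p :: nat
  assumes p: "prime p"
begin

lemma p_int: "prime (int p)" "prime_elem (int p)"
  using p by auto

lemma p_gt_1: "real p > 1"
  using prime_gt_1_nat[OF p] by simp

lemma rat_val_Fract:
  assumes "a \<noteq> 0" "b \<noteq> 0"
  shows "rat_val p (Rat.Fract a b) = int (multiplicity (int p) a) - int (multiplicity (int p) b)"
proof -
  obtain n d where nd: "quotient_of (Rat.Fract a b) = (n, d)" by fastforce
  have d: "d > 0" using quotient_of_denom_pos[OF nd] .
  have "Rat.Fract a b = Rat.Fract n d"
    using quotient_of_div[OF nd] by (simp add: Fract_of_int_quotient)
  hence eq: "a * d = n * b" using assms d by (simp add: eq_rat)
  have n: "n \<noteq> 0" using eq assms d by auto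
  have "multiplicity (int p) a + multiplicity (int p) d
      = multiplicity (int p) n + multiplicity (int p) b"
    using eq assms d n p_int
    by (metis less_irrefl prime_elem_multiplicity_mult_distrib)
  thus ?thesis by (simp add: rat_val_def nd)
qed

lemma rat_val_mult:
  assumes "x \<noteq> 0" "y \<noteq> 0"
  shows "rat_val p (x * y) = rat_val p x + rat_val p y"
proof -
  obtain a b where x: "x = Rat.Fract a b" "b > 0" by (cases x) auto
  obtain c d where y: "y = Rat.Fract c d" "d > 0" by (cases y) auto
  have "a \<noteq> 0" "c \<noteq> 0" using assms x y by (auto simp: rat_number_collapse)
  thus ?thesis using x y p_int
    by (simp add: rat_val_Fract prime_elem_multiplicity_mult_distrib)
qed

lemma rat_val_add:
  assumes "x \<noteq> 0" "y \<noteq> 0" "x + y \<noteq> 0"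
  shows "rat_val p (x + y) \<ge> min (rat_val p x) (rat_val p y)"
proof -
  obtain a b where x: "x = Rat.Fract a b" "b > 0" by (cases x) auto
  obtain c d where y: "y = Rat.Fract c d" "d > 0" by (cases y) auto
  define A C D where "A = a * d" and "C = c * b" and "D = b * d"
  have D: "D \<noteq> 0" using x y by (simp add: D_def)
  have xe: "x = Rat.Fract A D" and ye: "y = Rat.Fract C D" and se: "x + y = Rat.Fract (A + C) D"
    using x y by (auto simp: A_def C_def D_def eq_rat)
  have nz: "A \<noteq> 0" "C \<noteq> 0"
    using assms(1,2) unfolding xe ye by (auto simp: rat_number_collapse)
  have nz': "A + C \<noteq> 0"
    using assms(3) unfolding se by (auto simp: rat_number_collapse)
  let ?m = "min (multiplicity (int p) A) (multiplicity (int p) C)"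
  have "int p ^ ?m dvd A + C"
    by (intro dvd_add multiplicity_dvd') auto
  hence "?m \<le> multiplicity (int p) (A + C)"
    using nz' p_int by (intro multiplicity_geI) auto
  thus ?thesis unfolding se unfolding xe ye using nz nz' D by (simp add: rat_val_Fract)
qed

lemma pnorm_0 [simp]: "pnorm p 0 = 0"
  by (simp add: pnorm_def)

lemma pnorm_nonneg [simp]: "pnorm p x \<ge> 0"
  using p_gt_1 by (simp add: pnorm_def)

lemma pnorm_eq_0_iff [simp]: "pnorm p x = 0 \<longleftrightarrow> x = 0"
  using p_gt_1 by (simp add: pnorm_def)

lemma pnorm_mult: "pnorm p (x * y) = pnorm p x * pnorm p y"
  using p_gt_1 by (auto simp: pnorm_def rat_val_mult power_int_diff power_int_minus field_simps power_int_add)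

lemma pnorm_1 [simp]: "pnorm p 1 = 1"
  by (simp add: pnorm_def rat_val_def)

lemma pnorm_minus [simp]: "pnorm p (- x) = pnorm p x"
proof -
  have "pnorm p (-1) * pnorm p (-1) = 1"
    by (simp flip: pnorm_mult)
  hence "pnorm p (-1) = 1"
    using pnorm_nonneg[of "-1"] by (simp add: square_eq_1_iff)
  thus ?thesis using pnorm_mult[of "-1" x] by simp
qed

lemma pnorm_inverse: "pnorm p (inverse x) = inverse (pnorm p x)"
proof (cases "x = 0")
  case False
  have "pnorm p (inverse x) * pnorm p x = 1"
    using False by (simp flip: pnorm_mult)
  thus ?thesis using False by (simp add: field_simps)
qed auto

lemma pnorm_add: "pnorm p (x + y) \<le> max (pnorm p x) (pnorm p y)"
proof (cases "x = 0 \<or> y = 0 \<or> x + y = 0")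
  case True
  thus ?thesis by (auto simp: le_max_iff_disj)
next
  case False
  hence "rat_val p (x + y) \<ge> rat_val p x \<or> rat_val p (x + y) \<ge> rat_val p y"
    using rat_val_add[of x y] by linarith
  thus ?thesis using False p_gt_1
    by (auto simp: pnorm_def le_max_iff_disj intro!: power_int_increasing)
qed

lemma pnorm_diff: "pnorm p (x - y) \<le> max (pnorm p x) (pnorm p y)"
  using pnorm_add[of x "- y"] by simp

lemma pnorm_diff_commute: "pnorm p (x - y) = pnorm p (y - x)"
  using pnorm_minus[of "x - y"] by simp

lemma pnorm_triangle: "pnorm p (x + y) \<le> pnorm p x + pnorm p y"
  using pnorm_add[of x y] pnorm_nonneg[of x] pnorm_nonneg[of y] by linarith

lemma pnorm_diff_ineq: "\<bar>pnorm p x - pnorm p y\<bar> \<le> pnorm p (x - y)"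
  using pnorm_triangle[of "x - y" y] pnorm_triangle[of "y - x" x]
  by (simp add: pnorm_diff_commute[of y x])

end

section \<open>The field of \<open>p\<close>-adic numbers\<close>

definition pvanishes :: "nat \<Rightarrow> (nat \<Rightarrow> rat) \<Rightarrow> bool" where
  "pvanishes p X \<longleftrightarrow> (\<lambda>n. pnorm p (X n)) \<longlonglongrightarrow> 0"

definition pcauchy :: "nat \<Rightarrow> (nat \<Rightarrow> rat) \<Rightarrow> bool" where
  "pcauchy p X \<longleftrightarrow> (\<forall>e>0. \<exists>N. \<forall>m\<ge>N. \<forall>n\<ge>N. pnorm p (X m - X n) < e)"

context
  fixes p :: nat
  assumes p: "prime p"
begin

lemma pvanishes_iff: "pvanishes p X \<longleftrightarrow> (\<forall>e>0. \<exists>N. \<forall>n\<ge>N. pnorm p (X n) < e)"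
  by (auto simp: pvanishes_def lim_sequentially pnorm_nonneg[OF p] dist_real_def)

lemma pvanishes_0 [simp]: "pvanishes p (\<lambda>n. 0)"
  by (simp add: pvanishes_def pnorm_0[OF p])

lemma pvanishes_const: "pvanishes p (\<lambda>n. c) \<longleftrightarrow> c = 0"
  by (simp add: pvanishes_def LIMSEQ_const_iff pnorm_eq_0_iff[OF p])

lemma pvanishes_add: "pvanishes p X \<Longrightarrow> pvanishes p Y \<Longrightarrow> pvanishes p (\<lambda>n. X n + Y n)"
  unfolding pvanishes_def
  by (rule tendsto_sandwich[OF _ _ tendsto_const, where h = "\<lambda>n. pnorm p (X n) + pnorm p (Y n)"])
     (auto simp: pnorm_nonneg[OF p] pnorm_triangle[OF p] intro!: tendsto_eq_intros)

lemma pvanishes_minus: "pvanishes p (\<lambda>n. - X n) \<longleftrightarrow> pvanishes p X"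
  unfolding pvanishes_def by (simp add: pnorm_minus[OF p])

lemma pvanishes_diff: "pvanishes p X \<Longrightarrow> pvanishes p Y \<Longrightarrow> pvanishes p (\<lambda>n. X n - Y n)"
  using pvanishes_add[of X "\<lambda>n. - Y n"] by (simp add: pvanishes_minus)

lemma pvanishes_mult_bounded:
  assumes "\<And>n. pnorm p (X n) \<le> B" "pvanishes p Y"
  shows "pvanishes p (\<lambda>n. X n * Y n)"
  unfolding pvanishes_def
proof (rule tendsto_sandwich[OF _ _ tendsto_const, where h = "\<lambda>n. B * pnorm p (Y n)"])
  show "(\<lambda>n. B * pnorm p (Y n)) \<longlonglongrightarrow> 0"
    using assms(2) unfolding pvanishes_def by (rule tendsto_mult_right_zero)
qed (auto simp: pnorm_nonneg[OF p] pnorm_mult[OF p] intro!: mult_right_mono assms always_eventually)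

lemma pvanishes_cong:
  assumes "\<forall>\<^sub>F n in sequentially. X n = Y n"
  shows "pvanishes p X \<longleftrightarrow> pvanishes p Y"
  unfolding pvanishes_def
  by (rule filterlim_cong[OF refl refl]) (use assms in \<open>auto elim: eventually_mono\<close>)

lemma pcauchyD:
  "pcauchy p X \<Longrightarrow> e > 0 \<Longrightarrow> \<exists>N. \<forall>m\<ge>N. \<forall>n\<ge>N. pnorm p (X m - X n) < e"
  by (auto simp: pcauchy_def)

lemma pcauchy_const [simp]: "pcauchy p (\<lambda>n. c)"
  by (simp add: pcauchy_def pnorm_0[OF p])

lemma pcauchy_minus: "pcauchy p X \<Longrightarrow> pcauchy p (\<lambda>n. - X n)"
  by (simp add: pcauchy_def pnorm_diff_commute[OF p])

lemma pcauchy_add: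
  assumes "pcauchy p X" "pcauchy p Y"
  shows "pcauchy p (\<lambda>n. X n + Y n)"
  unfolding pcauchy_def
proof (intro allI impI)
  fix e :: real assume e: "e > 0"
  obtain M where M: "\<forall>m\<ge>M. \<forall>n\<ge>M. pnorm p (X m - X n) < e"
    using pcauchyD[OF assms(1) e] ..
  obtain N where N: "\<forall>m\<ge>N. \<forall>n\<ge>N. pnorm p (Y m - Y n) < e"
    using pcauchyD[OF assms(2) e] ..
  show "\<exists>N. \<forall>m\<ge>N. \<forall>n\<ge>N. pnorm p (X m + Y m - (X n + Y n)) < e"
  proof (intro exI[of _ "max M N"] allI impI)
    fix m n assume "max M N \<le> m" "max M N \<le> n"
    hence "max (pnorm p (X m - X n)) (pnorm p (Y m - Y n)) < e"
      using M N by simp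
    with pnorm_add[OF p, of "X m - X n" "Y m - Y n"]
    show "pnorm p (X m + Y m - (X n + Y n)) < e"
      unfolding add_diff_add by linarith
  qed
qed

lemma pcauchy_bounded:
  assumes "pcauchy p X"
  shows "\<exists>B>0. \<forall>n. pnorm p (X n) \<le> B"
proof -
  obtain N where N: "\<forall>m\<ge>N. \<forall>n\<ge>N. pnorm p (X m - X n) < 1"
    using pcauchyD[OF assms, of 1] by auto
  define B where "B = Max ((\<lambda>n. pnorm p (X n)) ` {..N}) + 1"
  have le: "pnorm p (X n) \<le> B - 1" if "n \<le> N" for n
    unfolding B_def using that by simp
  have "pnorm p (X n) \<le> B" for n
  proof (cases "n \<le> N")
    case False
    hence "pnorm p (X n - X N) < 1" using N by simp
    with pnorm_triangle[OF p, of "X n - X N" "X N"] le[of N] show ?thesis by simp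
  qed (use le[of n] in simp)
  moreover have "B > 0"
    using le[of 0] pnorm_nonneg[OF p, of "X 0"] by linarith
  ultimately show ?thesis by blast
qed

lemma pcauchy_mult:
  assumes "pcauchy p X" "pcauchy p Y"
  shows "pcauchy p (\<lambda>n. X n * Y n)"
  unfolding pcauchy_def
proof (intro allI impI)
  fix e :: real assume e: "e > 0"
  obtain B where B: "B > 0" "\<And>n. pnorm p (X n) \<le> B"
    using pcauchy_bounded[OF assms(1)] by blast
  obtain C where C: "C > 0" "\<And>n. pnorm p (Y n) \<le> C"
    using pcauchy_bounded[OF assms(2)] by blast
  obtain M where M: "\<forall>m\<ge>M. \<forall>n\<ge>M. pnorm p (X m - X n) < e / C"
    using pcauchyD[OF assms(1), of "e / C"] e C by auto
  obtain N where N: "\<forall>m\<ge>N. \<forall>n\<ge>N. pnorm p (Y m - Y n) < e / B"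
    using pcauchyD[OF assms(2), of "e / B"] e B by auto
  show "\<exists>N. \<forall>m\<ge>N. \<forall>n\<ge>N. pnorm p (X m * Y m - X n * Y n) < e"
  proof (intro exI[of _ "max M N"] allI impI)
    fix m n assume mn: "max M N \<le> m" "max M N \<le> n"
    have "X m * Y m - X n * Y n = X m * (Y m - Y n) + (X m - X n) * Y n"
      by (simp add: algebra_simps)
    hence "pnorm p (X m * Y m - X n * Y n)
         \<le> max (pnorm p (X m) * pnorm p (Y m - Y n)) (pnorm p (X m - X n) * pnorm p (Y n))"
      using pnorm_add[OF p, of "X m * (Y m - Y n)" "(X m - X n) * Y n"]
      by (simp add: pnorm_mult[OF p])
    also have "\<dots> < e"
    proof -
      have "pnorm p (X m) * pnorm p (Y m - Y n) \<le> B * pnorm p (Y m - Y n)"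
        by (intro mult_right_mono B pnorm_nonneg[OF p])
      also have "\<dots> < e" using N mn B by (simp add: field_simps)
      finally have 1: "pnorm p (X m) * pnorm p (Y m - Y n) < e" .
      have "pnorm p (X m - X n) * pnorm p (Y n) \<le> pnorm p (X m - X n) * C"
        by (intro mult_left_mono C pnorm_nonneg[OF p])
      also have "\<dots> < e" using M mn C by (simp add: field_simps)
      finally show ?thesis using 1 by simp
    qed
    finally show "pnorm p (X m * Y m - X n * Y n) < e" .
  qed
qed

lemma pcauchy_not_vanishes:
  assumes "pcauchy p X" "\<not> pvanishes p X"
  shows "\<exists>b>0. \<exists>N. \<forall>n\<ge>N. b \<le> pnorm p (X n)"
proof -
  obtain e where e: "e > 0" "\<And>N. \<exists>n\<ge>N. e \<le> pnorm p (X n)"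
    using assms(2) by (auto simp: pvanishes_iff not_less)
  obtain N where N: "\<forall>m\<ge>N. \<forall>n\<ge>N. pnorm p (X m - X n) < e"
    using pcauchyD[OF assms(1) e(1)] ..
  obtain k where k: "k \<ge> N" "e \<le> pnorm p (X k)" using e(2) by blast
  have "e \<le> pnorm p (X n)" if "n \<ge> N" for n
  proof -
    have "pnorm p (X k - X n) < e" using N k that by simp
    with pnorm_add[OF p, of "X k - X n" "X n"] k(2) show ?thesis by simp
  qed
  with e(1) show ?thesis by blast
qed

lemma pcauchy_inverse:
  assumes "pcauchy p X" "\<not> pvanishes p X"
  shows "pcauchy p (\<lambda>n. inverse (X n))"
  unfolding pcauchy_def
proof (intro allI impI)
  fix e :: real assume e: "e > 0"
  obtain b K where b: "b > 0" "\<And>n. n \<ge> K \<Longrightarrow> b \<le> pnorm p (X n)"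
    using pcauchy_not_vanishes[OF assms] by blast
  obtain N where N: "\<forall>m\<ge>N. \<forall>n\<ge>N. pnorm p (X m - X n) < e * b * b"
    using pcauchyD[OF assms(1), of "e * b * b"] e b by auto
  show "\<exists>N. \<forall>m\<ge>N. \<forall>n\<ge>N. pnorm p (inverse (X m) - inverse (X n)) < e"
  proof (intro exI[of _ "max K N"] allI impI)
    fix m n assume mn: "max K N \<le> m" "max K N \<le> n"
    have bm: "b \<le> pnorm p (X m)" and bn: "b \<le> pnorm p (X n)" using b mn by auto
    hence nz: "X m \<noteq> 0" "X n \<noteq> 0" using b(1) pnorm_0[OF p] by force+
    have "inverse (X m) - inverse (X n) = (X n - X m) * inverse (X m) * inverse (X n)"
      using nz by (simp add: field_simps)
    hence "pnorm p (inverse (X m) - inverse (X n))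
         = pnorm p (X n - X m) / (pnorm p (X m) * pnorm p (X n))"
      by (simp add: pnorm_mult[OF p] pnorm_inverse[OF p] divide_inverse mult.assoc)
    also have "\<dots> \<le> pnorm p (X n - X m) / (b * b)"
      using b(1) bm bn by (intro divide_left_mono mult_mono mult_pos_pos) (auto simp: pnorm_nonneg[OF p])
    also have "\<dots> < e"
      using N mn b(1) by (simp add: field_simps)
    finally show "pnorm p (inverse (X m) - inverse (X n)) < e" .
  qed
qed

lemma pvanishes_diff_inverse:
  assumes X: "pcauchy p X" "\<not> pvanishes p X" and Y: "pcauchy p Y" "\<not> pvanishes p Y"
    and XY: "pvanishes p (\<lambda>n. X n - Y n)"
  shows "pvanishes p (\<lambda>n. inverse (X n) - inverse (Y n))"
proof -
  obtain b K where b: "b > 0" "\<And>n. n \<ge> K \<Longrightarrow> b \<le> pnorm p (X n)"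
    using pcauchy_not_vanishes[OF X] by blast
  obtain c L where c: "c > 0" "\<And>n. n \<ge> L \<Longrightarrow> c \<le> pnorm p (Y n)"
    using pcauchy_not_vanishes[OF Y] by blast
  obtain B where B: "\<And>n. pnorm p (- (inverse (X n) * inverse (Y n))) \<le> B"
    using pcauchy_bounded[OF pcauchy_minus[OF pcauchy_mult[OF pcauchy_inverse[OF X] pcauchy_inverse[OF Y]]]]
    by blast
  have "\<forall>\<^sub>F n in sequentially.
          - (inverse (X n) * inverse (Y n)) * (X n - Y n) = inverse (X n) - inverse (Y n)"
    using eventually_ge_at_top[of "max K L"]
  proof eventually_elim
    case (elim n)
    hence "b \<le> pnorm p (X n)" "c \<le> pnorm p (Y n)" using b c by auto
    hence "X n \<noteq> 0" "Y n \<noteq> 0" using b(1) c(1) pnorm_0[OF p] by force+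
    thus ?case by (simp add: field_simps)
  qed
  from pvanishes_cong[OF this] pvanishes_mult_bounded[OF B XY] show ?thesis by simp
qed

lemma pcauchy_pnorm_convergent:
  assumes "pcauchy p X"
  shows "convergent (\<lambda>n. pnorm p (X n))"
proof -
  have "Cauchy (\<lambda>n. pnorm p (X n))"
    unfolding Cauchy_def dist_real_def
  proof (intro allI impI)
    fix e :: real assume "e > 0"
    from pcauchyD[OF assms this]
    show "\<exists>M. \<forall>m\<ge>M. \<forall>n\<ge>M. \<bar>pnorm p (X m) - pnorm p (X n)\<bar> < e"
      using pnorm_diff_ineq[OF p] by (meson le_less_trans)
  qed
  thus ?thesis by (simp add: Cauchy_convergent_iff)
qed

end


text \<open>
  The prime \<open>p\<close> is carried by the type: \<open>p = CARD('p)\<close>. The type \<open>'p padic\<close> is the completion of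
  the rationals for the \<open>p\<close>-adic absolute value, i.e. the ring of Cauchy sequences modulo the
  ideal of null sequences.
\<close>

typedef (overloaded) 'p padic_seq = "{X. pcauchy CARD('p::prime_card) X}"
  morphisms seq_of Abs_padic_seq
  using pcauchy_const[OF prime_card] by blast

setup_lifting type_definition_padic_seq

instantiation padic_seq :: (prime_card) comm_ring_1
begin

lift_definition zero_padic_seq :: "'a padic_seq" is "\<lambda>_. 0"
  by (rule pcauchy_const[OF prime_card])

lift_definition one_padic_seq :: "'a padic_seq" is "\<lambda>_. 1"
  by (rule pcauchy_const[OF prime_card])

lift_definition plus_padic_seq :: "'a padic_seq \<Rightarrow> 'a padic_seq \<Rightarrow> 'a padic_seq"
  is "\<lambda>X Y n. X n + Y n"
  by (rule pcauchy_add[OF prime_card])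

lift_definition uminus_padic_seq :: "'a padic_seq \<Rightarrow> 'a padic_seq" is "\<lambda>X n. - X n"
  by (rule pcauchy_minus[OF prime_card])

lift_definition minus_padic_seq :: "'a padic_seq \<Rightarrow> 'a padic_seq \<Rightarrow> 'a padic_seq"
  is "\<lambda>X Y n. X n - Y n"
  using pcauchy_add[OF prime_card _ pcauchy_minus[OF prime_card]] by simp

lift_definition times_padic_seq :: "'a padic_seq \<Rightarrow> 'a padic_seq \<Rightarrow> 'a padic_seq"
  is "\<lambda>X Y n. X n * Y n"
  by (rule pcauchy_mult[OF prime_card])

instance
  by standard (transfer; simp add: algebra_simps fun_eq_iff)+

end

lift_definition null_seq :: "'p::prime_card padic_seq \<Rightarrow> bool" is "pvanishes CARD('p)" .

lemma null_seq_0 [simp]: "null_seq 0"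
  by transfer (rule pvanishes_0[OF prime_card])

lemma null_seq_1 [simp]: "\<not> null_seq 1"
  by transfer (simp add: pvanishes_const[OF prime_card])

lemma null_seq_add: "null_seq X \<Longrightarrow> null_seq Y \<Longrightarrow> null_seq (X + Y)"
  by transfer (rule pvanishes_add[OF prime_card])

lemma null_seq_minus: "null_seq X \<Longrightarrow> null_seq (- X)"
  by transfer (simp add: pvanishes_minus[OF prime_card])

lemma null_seq_mult: "null_seq Y \<Longrightarrow> null_seq (X * Y)"
  by transfer (metis pcauchy_bounded prime_card pvanishes_mult_bounded)

lift_definition inverse_seq :: "'p::prime_card padic_seq \<Rightarrow> 'p padic_seq"
  is "\<lambda>X. if pvanishes CARD('p) X then (\<lambda>_. 0) else (\<lambda>n. inverse (X n))"
  by (auto intro: pcauchy_const[OF prime_card] pcauchy_inverse[OF prime_card])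

lemma inverse_seq_null: "null_seq X \<Longrightarrow> inverse_seq X = 0"
  by transfer simp

lemma null_seq_inverse_diff:
  "\<not> null_seq X \<Longrightarrow> \<not> null_seq Y \<Longrightarrow> null_seq (X - Y) \<Longrightarrow> null_seq (inverse_seq X - inverse_seq Y)"
  by transfer (simp add: pvanishes_diff_inverse[OF prime_card])

lemma inverse_seq_mult:
  fixes X :: "'p::prime_card padic_seq"
  assumes "\<not> null_seq X"
  shows "null_seq (inverse_seq X * X - 1)"
  using assms
proof transfer
  fix X assume X: "pcauchy CARD('p) X" "\<not> pvanishes CARD('p) X"
  obtain b N where b: "b > 0" "\<And>n. n \<ge> N \<Longrightarrow> b \<le> pnorm CARD('p) (X n)"
    using pcauchy_not_vanishes[OF prime_card X] by blast
  have "\<forall>\<^sub>F n in sequentially. inverse (X n) * X n - 1 = 0"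
    using eventually_ge_at_top[of N]
  proof eventually_elim
    case (elim n)
    hence "X n \<noteq> 0" using b(1) b(2)[of n] pnorm_0[OF prime_card[where ?'a = 'p]] by force
    thus ?case by simp
  qed
  from pvanishes_cong[OF prime_card this]
  show "pvanishes CARD('p)
     (\<lambda>n. (if pvanishes CARD('p) X then \<lambda>_. 0 else (\<lambda>n. inverse (X n))) n * X n - 1)"
    using X by (simp add: pvanishes_0[OF prime_card])
qed

definition padicrel :: "'p::prime_card padic_seq \<Rightarrow> 'p padic_seq \<Rightarrow> bool" where
  "padicrel X Y \<longleftrightarrow> null_seq (X - Y)"

lemma equivp_padicrel: "equivp padicrel"
proof (rule equivpI)
  show "reflp padicrel" by (simp add: reflp_def padicrel_def)
  show "symp padicrel"
    unfolding symp_def padicrel_def by (metis minus_diff_eq null_seq_minus)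
  show "transp padicrel"
    unfolding transp_def padicrel_def by (metis diff_add_cancel add_diff_eq null_seq_add)
qed

quotient_type 'p padic = "'p::prime_card padic_seq" / padicrel
  by (rule equivp_padicrel)

instantiation padic :: (prime_card) field
begin

lift_definition zero_padic :: "'a padic" is 0 .

lift_definition one_padic :: "'a padic" is 1 .

lift_definition plus_padic :: "'a padic \<Rightarrow> 'a padic \<Rightarrow> 'a padic" is "(+)"
  unfolding padicrel_def using null_seq_add by (metis add_diff_add)

lift_definition uminus_padic :: "'a padic \<Rightarrow> 'a padic" is uminus
  unfolding padicrel_def using null_seq_minus by (metis minus_diff_minus)

lift_definition minus_padic :: "'a padic \<Rightarrow> 'a padic \<Rightarrow> 'a padic" is "(-)"
proof -
  fix X Y X' Y' :: "'a padic_seq"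
  assume *: "padicrel X Y" "padicrel X' Y'"
  have "X - X' - (Y - Y') = (X - Y) + - (X' - Y')" by (simp add: algebra_simps)
  thus "padicrel (X - X') (Y - Y')"
    using * unfolding padicrel_def by (metis null_seq_add null_seq_minus)
qed

lift_definition times_padic :: "'a padic \<Rightarrow> 'a padic \<Rightarrow> 'a padic" is "(*)"
proof -
  fix X Y X' Y' :: "'a padic_seq"
  assume *: "padicrel X Y" "padicrel X' Y'"
  have "X * X' - Y * Y' = X * (X' - Y') + Y' * (X - Y)" by (simp add: algebra_simps)
  thus "padicrel (X * X') (Y * Y')"
    using * unfolding padicrel_def by (metis null_seq_add null_seq_mult)
qed

lift_definition inverse_padic :: "'a padic \<Rightarrow> 'a padic" is inverse_seq
proof -
  fix X Y :: "'a padic_seq"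
  assume *: "padicrel X Y"
  hence "null_seq X \<longleftrightarrow> null_seq Y"
    unfolding padicrel_def
    by (metis add.commute diff_add_cancel minus_diff_eq null_seq_add null_seq_minus)
  thus "padicrel (inverse_seq X) (inverse_seq Y)"
    using * unfolding padicrel_def
    by (cases "null_seq X") (simp_all add: inverse_seq_null null_seq_inverse_diff)
qed

definition divide_padic :: "'a padic \<Rightarrow> 'a padic \<Rightarrow> 'a padic" where
  "divide_padic x y = x * inverse y"

instance
proof
  fix a b c :: "'a padic"
  show "a + b + c = a + (b + c)" by transfer (simp add: padicrel_def algebra_simps)
  show "a + b = b + a" by transfer (simp add: padicrel_def algebra_simps)
  show "0 + a = a" by transfer (simp add: padicrel_def)
  show "- a + a = 0" by transfer (simp add: padicrel_def)
  show "a - b = a + - b" by transfer (simp add: padicrel_def)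
  show "a * b * c = a * (b * c)" by transfer (simp add: padicrel_def algebra_simps)
  show "a * b = b * a" by transfer (simp add: padicrel_def algebra_simps)
  show "1 * a = a" by transfer (simp add: padicrel_def)
  show "(a + b) * c = a * c + b * c" by transfer (simp add: padicrel_def algebra_simps)
  show "(0::'a padic) \<noteq> 1"
    by transfer (metis diff_0 minus_minus null_seq_1 null_seq_minus padicrel_def)
  show "a \<noteq> 0 \<Longrightarrow> inverse a * a = 1"
    by transfer (simp add: padicrel_def inverse_seq_mult)
  show "a div b = a * inverse b" by (simp add: divide_padic_def)
  show "inverse (0::'a padic) = 0"
    by transfer (simp add: padicrel_def inverse_seq_null)
qed

end

lemma seq_of_of_nat: "seq_of (of_nat n) = (\<lambda>_. of_nat n)"
  by (induction n) (simp_all add: zero_padic_seq.rep_eq one_padic_seq.rep_eq plus_padic_seq.rep_eq)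

lemma of_nat_padic: "(of_nat n :: 'p::prime_card padic) = abs_padic (of_nat n)"
  by (induction n) (simp_all add: zero_padic_def one_padic_def plus_padic.abs_eq)

instance padic :: (prime_card) field_char_0
proof
  show "inj (of_nat :: nat \<Rightarrow> 'a padic)"
  proof (rule injI)
    fix m n :: nat assume "(of_nat m :: 'a padic) = of_nat n"
    hence "null_seq (of_nat m - of_nat n :: 'a padic_seq)"
      by (simp add: of_nat_padic padic.abs_eq_iff padicrel_def)
    thus "m = n"
      by (simp add: null_seq.rep_eq minus_padic_seq.rep_eq seq_of_of_nat
          pvanishes_const[OF prime_card])
  qed
qed

lift_definition seq_norm :: "'p::prime_card padic_seq \<Rightarrow> real"
  is "\<lambda>X. lim (\<lambda>n. pnorm CARD('p) (X n))" .

lemma seq_norm_LIMSEQ: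
  "(\<lambda>n. pnorm CARD('p) (seq_of X n)) \<longlonglongrightarrow> seq_norm (X :: 'p::prime_card padic_seq)"
  by transfer (simp add: convergent_LIMSEQ_iff[symmetric] pcauchy_pnorm_convergent[OF prime_card])

lemma seq_norm_eq_0_iff: "seq_norm X = 0 \<longleftrightarrow> null_seq X"
  using seq_norm_LIMSEQ[of X] LIMSEQ_unique
  by (auto simp: null_seq.rep_eq pvanishes_def)

lift_definition padic_norm :: "'p::prime_card padic \<Rightarrow> real" is seq_norm
proof -
  fix X Y :: "'p padic_seq"
  assume "padicrel X Y"
  hence *: "(\<lambda>n. pnorm CARD('p) (seq_of X n - seq_of Y n)) \<longlonglongrightarrow> 0"
    by (simp add: padicrel_def null_seq.rep_eq pvanishes_def minus_padic_seq.rep_eq)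
  have "(\<lambda>n. pnorm CARD('p) (seq_of X n) - pnorm CARD('p) (seq_of Y n)) \<longlonglongrightarrow> 0"
    by (rule Lim_null_comparison[OF _ *]) (simp add: pnorm_diff_ineq[OF prime_card])
  moreover have "(\<lambda>n. pnorm CARD('p) (seq_of X n) - pnorm CARD('p) (seq_of Y n))
      \<longlonglongrightarrow> seq_norm X - seq_norm Y"
    by (intro tendsto_diff seq_norm_LIMSEQ)
  ultimately show "seq_norm X = seq_norm Y"
    using LIMSEQ_unique by fastforce
qed

lemma padic_norm_eq_0_iff: "padic_norm x = 0 \<longleftrightarrow> x = 0"
  by transfer (simp add: seq_norm_eq_0_iff padicrel_def)

lemma padic_norm_minus: "padic_norm (- x) = padic_norm x"
proof transfer
  fix X :: "'a padic_seq"
  show "seq_norm (- X) = seq_norm X"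
    using seq_norm_LIMSEQ[of X] seq_norm_LIMSEQ[of "- X"] LIMSEQ_unique
    by (simp add: uminus_padic_seq.rep_eq pnorm_minus[OF prime_card])
qed

lemma padic_norm_triangle: "padic_norm (x + y) \<le> padic_norm x + padic_norm y"
proof transfer
  fix X Y :: "'a padic_seq"
  show "seq_norm (X + Y) \<le> seq_norm X + seq_norm Y"
    by (rule LIMSEQ_le[OF seq_norm_LIMSEQ tendsto_add[OF seq_norm_LIMSEQ seq_norm_LIMSEQ]])
       (simp add: plus_padic_seq.rep_eq pnorm_triangle[OF prime_card])
qed

instantiation padic :: (prime_card) metric_space
begin

definition dist_padic :: "'a padic \<Rightarrow> 'a padic \<Rightarrow> real" where
  "dist_padic x y = padic_norm (x - y)"

definition uniformity_padic :: "('a padic \<times> 'a padic) filter" where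
  "uniformity_padic = (INF e\<in>{0 <..}. principal {(x, y). dist x y < e})"

definition open_padic :: "'a padic set \<Rightarrow> bool" where
  "open_padic S = (\<forall>x\<in>S. \<forall>\<^sub>F (x', y) in uniformity. x' = x \<longrightarrow> y \<in> S)"

instance
proof
  fix x y z :: "'a padic"
  show "dist x y = 0 \<longleftrightarrow> x = y" by (simp add: dist_padic_def padic_norm_eq_0_iff)
  show "dist x y \<le> dist x z + dist y z"
    using padic_norm_triangle[of "x - z" "z - y"] padic_norm_minus[of "z - y"]
    by (simp add: dist_padic_def)
qed (simp_all add: uniformity_padic_def open_padic_def)

end

section \<open>Browkin's function and the \<open>p\<close>-adic Jacobi--Perron algorithm\<close>

text \<open>
  \<open>x\<close> is a sequence of balanced digits of \<open>\<alpha>\<close>, starting at exponent \<open>k\<close> (which need not be the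
  valuation of \<open>\<alpha>\<close>: leading zeros are allowed and do not affect the truncation below).
\<close>

definition browkin_expansion :: "'p::prime_card padic \<Rightarrow> int \<Rightarrow> (int \<Rightarrow> int) \<Rightarrow> bool" where
  "browkin_expansion \<alpha> k x \<longleftrightarrow>
     (\<forall>j\<ge>k. - (real CARD('p) / 2) < of_int (x j) \<and> of_int (x j) < real CARD('p) / 2) \<and>
     (\<lambda>i. of_int (x (k + int i)) * of_nat CARD('p) powi (k + int i)) sums \<alpha>"

definition browkin_s :: "'p::prime_card padic \<Rightarrow> rat" where
  "browkin_s \<alpha> =
     (THE q. \<exists>k x. browkin_expansion \<alpha> k x \<and>
                   q = (\<Sum>j=k..0. of_int (x j) * of_nat CARD('p) powi j))"

text \<open>
  The pair of complete quotients \<open>(\<alpha>\<^sub>n, \<beta>\<^sub>n)\<close>; its value is only meaningful as long as the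
  algorithm has not stopped.
\<close>

fun jp :: "'p::prime_card padic \<Rightarrow> 'p padic \<Rightarrow> nat \<Rightarrow> 'p padic \<times> 'p padic" where
  "jp \<alpha> \<beta> 0 = (\<alpha>, \<beta>)"
| "jp \<alpha> \<beta> (Suc n) =
     (let (\<alpha>n, \<beta>n) = jp \<alpha> \<beta> n
      in (1 / (\<beta>n - of_rat (browkin_s \<beta>n)),
          (\<alpha>n - of_rat (browkin_s \<alpha>n)) / (\<beta>n - of_rat (browkin_s \<beta>n))))"

definition mcf_a :: "'p::prime_card padic \<Rightarrow> 'p padic \<Rightarrow> nat \<Rightarrow> rat" where
  "mcf_a \<alpha> \<beta> n = browkin_s (fst (jp \<alpha> \<beta> n))"

definition mcf_b :: "'p::prime_card padic \<Rightarrow> 'p padic \<Rightarrow> nat \<Rightarrow> rat" where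
  "mcf_b \<alpha> \<beta> n = browkin_s (snd (jp \<alpha> \<beta> n))"

definition infinite_mcf :: "'p::prime_card padic \<Rightarrow> 'p padic \<Rightarrow> bool" where
  "infinite_mcf \<alpha> \<beta> \<longleftrightarrow> (\<forall>n. snd (jp \<alpha> \<beta> n) \<noteq> of_rat (mcf_b \<alpha> \<beta> n))"

text \<open>
  Solution of \<open>X\<^sub>n = a\<^sub>n X\<^sub>n\<^sub>-\<^sub>1 + b\<^sub>n X\<^sub>n\<^sub>-\<^sub>2 + X\<^sub>n\<^sub>-\<^sub>3\<close> (\<open>n \<ge> 1\<close>) with initial values
  \<open>u = X\<^sub>-\<^sub>2\<close>, \<open>v = X\<^sub>-\<^sub>1\<close>, \<open>w = X\<^sub>0\<close>. The index is shifted by two: argument \<open>m\<close> gives \<open>X\<^sub>m\<^sub>-\<^sub>2\<close>.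
\<close>

fun mcf_rec :: "(nat \<Rightarrow> rat) \<Rightarrow> (nat \<Rightarrow> rat) \<Rightarrow> rat \<Rightarrow> rat \<Rightarrow> rat \<Rightarrow> nat \<Rightarrow> rat" where
  "mcf_rec a b u v w 0 = u"
| "mcf_rec a b u v w (Suc 0) = v"
| "mcf_rec a b u v w (Suc (Suc 0)) = w"
| "mcf_rec a b u v w (Suc (Suc (Suc m))) =
     a (Suc m) * mcf_rec a b u v w (Suc (Suc m))
   + b (Suc m) * mcf_rec a b u v w (Suc m)
   + mcf_rec a b u v w m"

definition mcf_A :: "'p::prime_card padic \<Rightarrow> 'p padic \<Rightarrow> nat \<Rightarrow> rat" where
  "mcf_A \<alpha> \<beta> n = mcf_rec (mcf_a \<alpha> \<beta>) (mcf_b \<alpha> \<beta>) 0 1 (mcf_a \<alpha> \<beta> 0) (n + 2)"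

definition mcf_B :: "'p::prime_card padic \<Rightarrow> 'p padic \<Rightarrow> nat \<Rightarrow> rat" where
  "mcf_B \<alpha> \<beta> n = mcf_rec (mcf_a \<alpha> \<beta>) (mcf_b \<alpha> \<beta>) 1 0 (mcf_b \<alpha> \<beta> 0) (n + 2)"

definition mcf_C :: "'p::prime_card padic \<Rightarrow> 'p padic \<Rightarrow> nat \<Rightarrow> rat" where
  "mcf_C \<alpha> \<beta> n = mcf_rec (mcf_a \<alpha> \<beta>) (mcf_b \<alpha> \<beta>) 0 0 1 (n + 2)"

definition Q_alpha :: "'p::prime_card padic \<Rightarrow> 'p padic \<Rightarrow> nat \<Rightarrow> rat" where
  "Q_alpha \<alpha> \<beta> n = mcf_A \<alpha> \<beta> n / mcf_C \<alpha> \<beta> n"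

definition Q_beta :: "'p::prime_card padic \<Rightarrow> 'p padic \<Rightarrow> nat \<Rightarrow> rat" where
  "Q_beta \<alpha> \<beta> n = mcf_B \<alpha> \<beta> n / mcf_C \<alpha> \<beta> n"

text \<open>
  Both are meant for \<open>n \<ge> 1\<close>, where \<open>a\<^sub>n \<noteq> 0\<close> for an infinite expansion.
\<close>

definition mcf_k :: "'p::prime_card padic \<Rightarrow> 'p padic \<Rightarrow> nat \<Rightarrow> ereal" where
  "mcf_k \<alpha> \<beta> n = padic_val CARD('p) (1 / mcf_a \<alpha> \<beta> n)"

definition mcf_h :: "'p::prime_card padic \<Rightarrow> 'p padic \<Rightarrow> nat \<Rightarrow> ereal" where
  "mcf_h \<alpha> \<beta> n = padic_val CARD('p) (mcf_b \<alpha> \<beta> n / mcf_a \<alpha> \<beta> n)"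

section \<open>Bivariate polynomials over the rationals\<close>

text \<open>
  \<open>F(X,Y) \<in> \<rat>[X][Y]\<close>: the outer variable is \<open>Y\<close>, the coefficients are polynomials in \<open>X\<close>.
\<close>

definition eval2 :: "rat poly poly \<Rightarrow> 'a::field_char_0 \<Rightarrow> 'a \<Rightarrow> 'a" where
  "eval2 F x y = poly (map_poly (\<lambda>c. poly (map_poly of_rat c) x) F) y"

definition alg_indep2 :: "'a::field_char_0 \<Rightarrow> 'a \<Rightarrow> bool" where
  "alg_indep2 x y \<longleftrightarrow> (\<forall>F :: rat poly poly. F \<noteq> 0 \<longrightarrow> eval2 F x y \<noteq> 0)"

end

theory Submission
  imports Defs "HOL-Number_Theory.Cong"
begin

text \<open>
  Suppose \<open>F(\<alpha>, \<beta>) = 0\<close> with \<open>F \<noteq> 0\<close>; the same \<open>F\<close> annihilates almost all convergents. Up to a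
  fixed integer factor, \<open>z\<^sub>n = C\<^sub>n\<^sup>e F(Q\<^sub>n\<^sup>\<alpha>, Q\<^sub>n\<^sup>\<beta>)\<close> lies in \<open>\<int>[1/p]\<close> for a suitable \<open>e\<close>, so if it is
  nonzero then \<open>|z\<^sub>n|\<^sub>p |z\<^sub>n| \<ge> 1\<close>. Put \<open>G\<^sub>n = |C\<^sub>n|\<^sub>p = |a\<^sub>1 \<dots> a\<^sub>n|\<^sub>p \<ge> p\<^sup>n\<close>. Browkin's function takes values
  smaller than \<open>p/2\<close>, so \<open>A\<^sub>n, B\<^sub>n, C\<^sub>n\<close> are \<open>O(p\<^sup>n)\<close> in the real absolute value and \<open>|z\<^sub>n|\<close> is bounded by
  a power of \<open>G\<^sub>n\<close>. On the other hand \<open>F(Q\<^sub>n\<^sup>\<alpha>, Q\<^sub>n\<^sup>\<beta>)\<close> is \<open>p\<close>-adically as small as the error of the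
  convergents, which is at most a constant times \<open>\<delta>\<^sub>n\<^sub>+\<^sub>1 = max(|b\<^sub>n\<^sub>+\<^sub>1|\<^sub>p, 1) / |a\<^sub>n\<^sub>+\<^sub>1|\<^sub>p\<close>. The limit hypotheses
  say that \<open>\<delta>\<^sub>n\<^sub>+\<^sub>1\<close> beats every power of \<open>|a\<^sub>n|\<^sub>p\<close>, and they give \<open>G\<^sub>n = O(|a\<^sub>n|\<^sub>p\<^sup>2)\<close>; hence
  \<open>z\<^sub>n = 0\<close> for large \<open>n\<close>.
\<close>

section \<open>The absolute value on the \<open>p\<close>-adic numbers\<close>

lemma padic_norm_mult: "padic_norm (x * y) = padic_norm x * padic_norm (y :: 'p::prime_card padic)"
proof transfer
  fix X Y :: "'p padic_seq"
  have "(\<lambda>n. pnorm CARD('p) (seq_of (X * Y) n)) \<longlonglongrightarrow> seq_norm X * seq_norm Y"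
    using tendsto_mult[OF seq_norm_LIMSEQ[of X] seq_norm_LIMSEQ[of Y]]
    by (simp add: times_padic_seq.rep_eq pnorm_mult[OF prime_card])
  thus "seq_norm (X * Y) = seq_norm X * seq_norm Y"
    using LIMSEQ_unique seq_norm_LIMSEQ by blast
qed

lemma padic_norm_add_le_max:
  "padic_norm (x + y) \<le> max (padic_norm x) (padic_norm (y :: 'p::prime_card padic))"
proof transfer
  fix X Y :: "'p padic_seq"
  show "seq_norm (X + Y) \<le> max (seq_norm X) (seq_norm Y)"
    by (rule LIMSEQ_le[OF seq_norm_LIMSEQ tendsto_max[OF seq_norm_LIMSEQ seq_norm_LIMSEQ]])
       (simp add: plus_padic_seq.rep_eq pnorm_add[OF prime_card])
qed

lemma padic_norm_nonneg [simp]: "0 \<le> padic_norm (x :: 'p::prime_card padic)"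
proof transfer
  fix X :: "'p padic_seq"
  show "0 \<le> seq_norm X"
    by (rule LIMSEQ_le_const[OF seq_norm_LIMSEQ]) (simp add: pnorm_nonneg[OF prime_card])
qed

lemma padic_norm_diff_le_max:
  "padic_norm (x - y) \<le> max (padic_norm x) (padic_norm (y :: 'p::prime_card padic))"
  using padic_norm_add_le_max[of x "- y"] by (simp add: padic_norm_minus)

lemma padic_norm_minus_commute: "padic_norm (x - y) = padic_norm (y - x :: 'p::prime_card padic)"
  using padic_norm_minus[of "x - y"] by simp

text \<open>Isosceles principle of the ultrametric: an error smaller than the norm of
  \<open>x\<close> leaves that norm unchanged. It reads the norm of a complete quotient off its
  rational truncation.\<close>

lemma padic_norm_eq_of_diff_less:
  fixes x y :: "'p::prime_card padic"
  assumes "padic_norm (x - y) < padic_norm x"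
  shows "padic_norm y = padic_norm x"
  using assms padic_norm_add_le_max[of "x - y" y] padic_norm_diff_le_max[of x "x - y"] by auto

text \<open>The constant sequences are the rationals inside the completion. \<open>of_rat\<close> is
  defined through the field operations, so its representing sequence has to be identified
  separately, in \<open>of_rat_padic\<close>.\<close>

lift_definition const_seq :: "rat \<Rightarrow> 'p::prime_card padic_seq" is "\<lambda>q _. q"
  by (rule pcauchy_const[OF prime_card])

lemma const_seq_mult: "const_seq (q * r) = const_seq q * const_seq r"
  by transfer simp

lemma const_seq_minus: "const_seq (- q) = - const_seq q"
  by transfer simp

lemma const_seq_of_nat: "const_seq (of_nat n) = of_nat n"
  by (rule seq_of_inject[THEN iffD1]) (simp add: const_seq.rep_eq seq_of_of_nat)

lemma const_seq_of_int: "const_seq (of_int n) = of_int n"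
  by (cases n) (simp_all add: const_seq_of_nat const_seq_minus del: of_nat_Suc)

lemma of_int_padic: "(of_int n :: 'p::prime_card padic) = abs_padic (of_int n)"
  by (cases n) (simp_all add: of_nat_padic uminus_padic.abs_eq del: of_nat_Suc)

lemma of_rat_padic: "(of_rat q :: 'p::prime_card padic) = abs_padic (const_seq q)"
proof -
  obtain a b where ab: "quotient_of q = (a, b)" by fastforce
  have b: "b > 0" using quotient_of_denom_pos[OF ab] .
  have q: "q = of_int a / of_int b" using quotient_of_div[OF ab] .
  have "abs_padic (const_seq q) * (of_int b :: 'p padic) = abs_padic (const_seq (q * of_int b))"
    by (simp add: of_int_padic const_seq_mult const_seq_of_int times_padic.abs_eq)
  also have "\<dots> = of_int a" using b q by (simp add: const_seq_of_int of_int_padic)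
  finally show ?thesis using b by (simp add: q of_rat_divide field_simps)
qed

lemma padic_norm_of_rat: "padic_norm (of_rat q :: 'p::prime_card padic) = pnorm CARD('p) q"
  using LIMSEQ_unique[OF seq_norm_LIMSEQ[of "const_seq q :: 'p padic_seq"], of "pnorm CARD('p) q"]
  by (simp add: of_rat_padic padic_norm.abs_eq const_seq.rep_eq)

lemma padic_norm_0 [simp]: "padic_norm (0 :: 'p::prime_card padic) = 0"
  by (simp add: padic_norm_eq_0_iff)

lemma padic_norm_1 [simp]: "padic_norm (1 :: 'p::prime_card padic) = 1"
  using padic_norm_of_rat[of 1, where 'p = 'p] by (simp add: pnorm_1[OF prime_card])

lemma padic_norm_power: "padic_norm (x ^ n :: 'p::prime_card padic) = padic_norm x ^ n"
  by (induction n) (simp_all add: padic_norm_mult)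

lemma padic_norm_inverse: "padic_norm (inverse x :: 'p::prime_card padic) = inverse (padic_norm x)"
proof (cases "x = 0")
  case False
  hence "padic_norm (inverse x) * padic_norm x = 1" by (simp flip: padic_norm_mult)
  thus ?thesis using inverse_unique by (metis mult.commute)
qed auto

lemma padic_norm_divide: "padic_norm (x / y :: 'p::prime_card padic) = padic_norm x / padic_norm y"
  by (simp add: divide_inverse padic_norm_mult padic_norm_inverse)

lemma padic_norm_sum_le:
  "padic_norm (sum f S :: 'p::prime_card padic) \<le> (\<Sum>i\<in>S. padic_norm (f i))"
  by (induction S rule: infinite_finite_induct)
     (auto intro: order_trans[OF padic_norm_triangle])

lemma padic_norm_sum_le_bound:
  assumes "\<And>i. i \<in> S \<Longrightarrow> padic_norm (f i :: 'p::prime_card padic) \<le> c" "0 \<le> c"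
  shows "padic_norm (sum f S) \<le> c"
  using assms
  by (induction S rule: infinite_finite_induct)
     (auto intro: order_trans[OF padic_norm_add_le_max])

text \<open>A late term of a representing Cauchy sequence serves; e/2 keeps the limit inequality
  strict.\<close>

lemma rat_dense_padic:
  fixes x :: "'p::prime_card padic"
  assumes "0 < e"
  obtains r where "padic_norm (x - of_rat r) < e"
proof -
  obtain X where x: "x = abs_padic X" by (metis Quotient3_abs_rep Quotient3_padic)
  have "pcauchy CARD('p) (seq_of X)" using seq_of[of X] by simp
  from pcauchyD[OF prime_card this, of "e/2"] assms
  obtain N where N: "\<forall>m\<ge>N. \<forall>n\<ge>N. pnorm CARD('p) (seq_of X m - seq_of X n) < e/2" by auto
  have "padic_norm (x - of_rat (seq_of X N)) = seq_norm (X - const_seq (seq_of X N))"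
    by (simp add: x of_rat_padic minus_padic.abs_eq padic_norm.abs_eq)
  also have "\<dots> \<le> e/2"
    by (rule LIMSEQ_le_const2[OF seq_norm_LIMSEQ], rule exI[of _ N])
       (use N in \<open>auto simp: minus_padic_seq.rep_eq const_seq.rep_eq intro: less_imp_le\<close>)
  finally show ?thesis using assms that[of "seq_of X N"] by simp
qed

section \<open>Norms of integers and discreteness of the value group\<close>

lemma pnorm_of_int:
  assumes "prime p" "a \<noteq> 0"
  shows "pnorm p (of_int a) = real p powi (- int (multiplicity (int p) a))"
  using rat_val_Fract[OF assms(1), of a 1] assms by (simp add: pnorm_def Fract_of_int_quotient)

lemma pnorm_of_int_le_1: "prime p \<Longrightarrow> pnorm p (of_int a) \<le> 1"
  using p_gt_1[of p]
  by (cases "a = 0") (auto simp: pnorm_of_int power_int_minus pnorm_0 inverse_le_1_iff)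

lemma pnorm_of_int_less_1:
  assumes "prime p"
  shows "pnorm p (of_int a) < 1 \<longleftrightarrow> int p dvd a"
proof (cases "a = 0")
  case False
  have "\<not> is_unit (int p)" using assms by (auto dest: prime_gt_1_nat)
  hence "multiplicity (int p) a = 0 \<longleftrightarrow> \<not> int p dvd a"
    using False by (auto simp: multiplicity_eq_zero_iff)
  moreover have "real p powi (- int m) < 1 \<longleftrightarrow> m \<noteq> 0" for m
  proof (cases m)
    case (Suc k)
    have "1 < real p ^ m" using p_gt_1[OF assms] Suc by (intro one_less_power) auto
    hence "real p powi (- int m) < 1" by (simp add: power_int_minus inverse_less_1_iff)
    thus ?thesis using Suc by simp
  qed simp
  ultimately show ?thesis by (simp only: pnorm_of_int[OF assms False]) blast
qed (auto simp: assms pnorm_0)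

lemma pnorm_prime:
  assumes "prime p"
  shows "pnorm p (of_nat p) = 1 / real p"
  using pnorm_of_int[OF assms, of "int p"] assms prime_gt_0_nat[OF assms]
  by (simp add: power_int_minus field_simps)

lemma pnorm_power: "prime p \<Longrightarrow> pnorm p (q ^ n) = pnorm p q ^ n"
  by (induction n) (simp_all add: pnorm_1 pnorm_mult)

text \<open>Nonzero norms are integral powers of p, so none lies strictly between 1 and p.\<close>

lemma pnorm_gt_1_imp_ge:
  assumes "prime p" "pnorm p q > 1"
  shows "pnorm p q \<ge> real p"
proof -
  have q: "q \<noteq> 0" using assms by (auto simp: pnorm_0)
  have "- rat_val p q > 0"
  proof (rule ccontr)
    assume "\<not> ?thesis"
    hence "real p powi (- rat_val p q) \<le> real p powi 0"
      using p_gt_1[OF assms(1)] by (intro power_int_increasing) auto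
    thus False using assms q by (simp add: pnorm_def)
  qed
  hence "real p powi 1 \<le> real p powi (- rat_val p q)"
    using p_gt_1[OF assms(1)] by (intro power_int_increasing) auto
  thus ?thesis using q by (simp add: pnorm_def)
qed

lemma pnorm_less_1_imp_le:
  assumes "prime p" "pnorm p q < 1"
  shows "pnorm p q \<le> 1 / real p"
proof (cases "q = 0")
  case False
  hence pos: "pnorm p q > 0" using pnorm_eq_0_iff[OF assms(1)] pnorm_nonneg[OF assms(1)]
    by (simp add: less_le)
  hence "pnorm p (inverse q) > 1" using assms(2) by (simp add: pnorm_inverse[OF assms(1)] one_less_inverse)
  from pnorm_gt_1_imp_ge[OF assms(1) this] have "real p \<le> inverse (pnorm p q)"
    by (simp only: pnorm_inverse[OF assms(1)])
  thus ?thesis using pos prime_gt_0_nat[OF assms(1)] by (simp add: field_simps)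
qed (simp add: assms pnorm_0)

text \<open>Completion adds no new norms: a rational closer to \<open>x\<close> than the norm of
  \<open>x\<close> has the same norm.\<close>

lemma padic_norm_less_1_imp_le:
  fixes x :: "'p::prime_card padic"
  assumes "padic_norm x < 1"
  shows "padic_norm x \<le> 1 / real CARD('p)"
proof (cases "x = 0")
  case False
  hence "padic_norm x > 0" using padic_norm_eq_0_iff[of x] padic_norm_nonneg[of x] by linarith
  then obtain r where "padic_norm (x - of_rat r) < padic_norm x" by (rule rat_dense_padic)
  hence "padic_norm x = pnorm CARD('p) r"
    using padic_norm_eq_of_diff_less padic_norm_of_rat by metis
  thus ?thesis using pnorm_less_1_imp_le[OF prime_card] assms by metis
qed simp

section \<open>The ring \<open>\<int>[1/p]\<close>\<close>

text \<open>Membership in Z[1/p], where denominators are powers of p; not p-integrality in the sense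
  of nonnegative valuation.\<close>

definition p_integer :: "nat \<Rightarrow> rat \<Rightarrow> bool" where
  "p_integer p q \<longleftrightarrow> (\<exists>t. q * of_nat p ^ t \<in> \<int>)"

lemma p_integer_mult:
  assumes "p_integer p q" "p_integer p r" shows "p_integer p (q * r)"
proof -
  obtain s t where "q * of_nat p ^ s \<in> \<int>" "r * of_nat p ^ t \<in> \<int>"
    using assms by (auto simp: p_integer_def)
  from Ints_mult[OF this] show ?thesis
    unfolding p_integer_def by (intro exI[of _ "s + t"]) (simp add: power_add mult_ac)
qed

lemma p_integer_add:
  assumes "p_integer p q" "p_integer p r" shows "p_integer p (q + r)"
proof -
  obtain s t where *: "q * of_nat p ^ s \<in> \<int>" "r * of_nat p ^ t \<in> \<int>"
    using assms by (auto simp: p_integer_def)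
  have "(q * of_nat p ^ s) * of_nat p ^ t + (r * of_nat p ^ t) * of_nat p ^ s \<in> \<int>"
    by (intro Ints_add Ints_mult[OF *(1)] Ints_mult[OF *(2)] Ints_power) auto
  thus ?thesis
    unfolding p_integer_def by (intro exI[of _ "s + t"]) (simp add: power_add algebra_simps)
qed

lemma p_integer_Ints: "q \<in> \<int> \<Longrightarrow> p_integer p q"
  unfolding p_integer_def by (intro exI[of _ 0]) simp

lemma p_integer_power: "p_integer p q \<Longrightarrow> p_integer p (q ^ n)"
  by (induction n) (simp_all add: p_integer_Ints p_integer_mult)

lemma p_integer_sum: "(\<And>i. i \<in> S \<Longrightarrow> p_integer p (f i)) \<Longrightarrow> p_integer p (sum f S)"
  by (induction S rule: infinite_finite_induct) (simp_all add: p_integer_Ints p_integer_add)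

lemma p_integer_diff: "p_integer p q \<Longrightarrow> p_integer p r \<Longrightarrow> p_integer p (q - r)"
  using p_integer_add[of p q "- 1 * r"] p_integer_mult[of p "- 1" r] by (simp add: p_integer_Ints)

lemma p_integer_powi: "p > 0 \<Longrightarrow> p_integer p (of_nat p powi j)"
proof (cases "j \<ge> 0")
  case False
  assume "p > 0"
  hence "of_nat p powi j * of_nat p ^ nat (- j) = (1 :: rat)"
    using False by (simp add: power_int_def flip: power_mult_distrib)
  thus ?thesis unfolding p_integer_def by (metis Ints_1)
qed (simp add: p_integer_Ints power_int_def)

text \<open>Product formula: for \<open>q = a / p\<^sup>t\<close> the product is \<open>|a|\<close> stripped of its factors \<open>p\<close>.\<close>

lemma p_integer_norm_ge_1:
  assumes p: "prime p" and q: "p_integer p q" "q \<noteq> 0"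
  shows "1 \<le> pnorm p q * \<bar>real_of_rat q\<bar>"
proof -
  obtain t a where a: "q * of_nat p ^ t = of_int a" using q by (auto simp: p_integer_def elim: Ints_cases)
  have p0: "real p > 1" using p_gt_1[OF p] .
  have a0: "a \<noteq> 0" using a q p0 by auto
  let ?m = "multiplicity (int p) a"
  have "pnorm p q * (1 / real p) ^ t = pnorm p (of_int a)"
    unfolding a[symmetric] by (simp add: pnorm_mult[OF p] pnorm_power[OF p] pnorm_prime[OF p])
  hence 1: "pnorm p q = real p ^ t / real p ^ ?m"
    using p0 by (simp add: pnorm_of_int[OF p a0] power_int_minus field_simps)
  have "real_of_rat q * real p ^ t = of_int a"
    using arg_cong[OF a, of real_of_rat] by (simp add: of_rat_mult of_rat_power)
  hence "\<bar>real_of_rat q\<bar> * real p ^ t = of_int \<bar>a\<bar>"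
    by (metis abs_mult abs_of_nonneg of_int_abs of_nat_0_le_iff of_nat_power)
  hence 2: "pnorm p q * \<bar>real_of_rat q\<bar> = of_int \<bar>a\<bar> / real p ^ ?m" unfolding 1 by (simp add: mult_ac)
  have "int p ^ ?m dvd \<bar>a\<bar>" by (simp add: multiplicity_dvd)
  hence "int p ^ ?m \<le> \<bar>a\<bar>" using a0 by (intro zdvd_imp_le) auto
  hence "real p ^ ?m \<le> of_int \<bar>a\<bar>" by (metis of_int_le_iff of_int_of_nat_eq of_int_power)
  thus ?thesis unfolding 2 using p0 by (simp add: field_simps)
qed

section \<open>Browkin's function\<close>

lemma padic_norm_of_int_le_1: "padic_norm (of_int a :: 'p::prime_card padic) \<le> 1"
  using padic_norm_of_rat[of "of_int a", where 'p = 'p] pnorm_of_int_le_1[OF prime_card] by simp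

lemma padic_norm_card: "padic_norm (of_nat CARD('p) :: 'p::prime_card padic) = 1 / real CARD('p)"
  using padic_norm_of_rat[of "of_nat CARD('p)", where 'p = 'p] pnorm_prime[OF prime_card, where 'a1 = 'p]
  by simp

lemma padic_norm_card_powi:
  "padic_norm (of_nat CARD('p) powi j :: 'p::prime_card padic) = real CARD('p) powi (- j)"
  by (auto simp: power_int_def padic_norm_power padic_norm_inverse padic_norm_card padic_norm_divide power_divide inverse_eq_divide)

text \<open>Shifting by half of p before reducing modulo p centres the residues at 0; for odd p the
  resulting range is symmetric.\<close>

lemma balanced_residue:
  fixes a :: int
  assumes "odd p"
  obtains d where "int p dvd a - d" "2 * \<bar>d\<bar> < int p"
proof -
  have p: "int p = 2 * (int p div 2) + 1" using assms by presburger
  define h where "h = int p div 2"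
  define m where "m = (a + h) mod int p"
  define d where "d = m - h"
  have "int p dvd (a + h) - (a + h) mod int p" by simp
  hence 1: "int p dvd a - d" by (simp add: d_def m_def algebra_simps)
  have "0 \<le> m" "m < int p" using odd_pos[OF assms] by (simp_all add: m_def)
  hence "\<bar>d\<bar> \<le> h" using p unfolding h_def[symmetric] d_def by linarith
  hence "2 * \<bar>d\<bar> < int p" using p unfolding h_def[symmetric] by linarith
  with 1 show ?thesis by (rule that)
qed

text \<open>In lowest terms, norm at most 1 means that p does not divide the denominator, which is
  then invertible modulo p; the witness is the numerator times that inverse.\<close>

lemma pnorm_le_1_integer_approx:
  assumes p: "prime p" and r: "pnorm p r \<le> 1"
  obtains d :: int where "pnorm p (r - of_int d) < 1"
proof -
  obtain a b where ab: "quotient_of r = (a, b)" by fastforce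
  have b: "b > 0" using quotient_of_denom_pos[OF ab] .
  have cop: "coprime a b" using quotient_of_coprime[OF ab] .
  have rr: "r = of_int a / of_int b" using quotient_of_div[OF ab] .
  have nr: "pnorm p r * pnorm p (of_int b) = pnorm p (of_int a)"
    using b by (simp add: rr flip: pnorm_mult[OF p])
  have ndvd: "\<not> int p dvd b"
  proof
    assume dvd: "int p dvd b"
    hence "pnorm p (of_int b) < 1" by (simp add: pnorm_of_int_less_1[OF p])
    moreover have "pnorm p (of_int b) \<ge> 0" by (rule pnorm_nonneg[OF p])
    ultimately have "pnorm p (of_int a) < 1"
      using r nr pnorm_nonneg[OF p, of r] mult_left_le_one_le[of "pnorm p (of_int b)" "pnorm p r"]
      by linarith
    hence "int p dvd a" by (simp add: pnorm_of_int_less_1[OF p])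
    with dvd cop have "is_unit (int p)" by (rule coprime_common_divisor[rotated -1]) 
    thus False using p by (auto dest: prime_gt_1_nat)
  qed
  hence nb: "pnorm p (of_int b) = 1"
    using pnorm_of_int_less_1[OF p, of b] pnorm_of_int_le_1[OF p, of b] by linarith
  have "coprime (int p) b" using ndvd p by (intro prime_imp_coprime) auto
  hence "\<exists>t. [b * t = 1] (mod int p)" by (simp add: cong_solve_coprime_int coprime_commute)
  then obtain t where t: "[b * t = 1] (mod int p)" by blast
  hence "int p dvd a * (b * t - 1)" by (simp add: cong_iff_dvd_diff)
  hence "int p dvd a - b * (a * t)" by (metis dvd_minus_iff minus_diff_eq mult.left_commute mult.right_neutral right_diff_distrib)
  hence "pnorm p (of_int (a - b * (a * t))) < 1" by (simp only: pnorm_of_int_less_1[OF p])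
  moreover have "of_int b * (r - of_int (a * t)) = of_int (a - b * (a * t))"
    using b by (simp add: rr field_simps)
  ultimately have "pnorm p (of_int b * (r - of_int (a * t))) < 1" by simp
  hence "pnorm p (r - of_int (a * t)) < 1" by (simp only: pnorm_mult[OF p] nb mult_1)
  thus ?thesis by (rule that)
qed

text \<open>Three successive approximations, by a rational, an integer and a balanced residue;
  discreteness of the norm improves \<open>< 1\<close> to \<open>1 / p\<close>.\<close>

lemma balanced_digit_exists:
  fixes x :: "'p::prime_card padic"
  assumes "odd CARD('p)" and x: "padic_norm x \<le> 1"
  shows "\<exists>d. 2 * \<bar>d\<bar> < int CARD('p) \<and> padic_norm (x - of_int d) \<le> 1 / real CARD('p)"
proof -
  obtain r where r: "padic_norm (x - of_rat r) < 1" by (rule rat_dense_padic[of 1 x]) auto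
  have "padic_norm (of_rat r :: 'p padic) \<le> 1"
    using padic_norm_diff_le_max[of x "x - of_rat r"] r x by simp
  hence "pnorm CARD('p) r \<le> 1" by (simp add: padic_norm_of_rat)
  then obtain c where c: "pnorm CARD('p) (r - of_int c) < 1"
    by (rule pnorm_le_1_integer_approx[OF prime_card])
  obtain d where d: "int CARD('p) dvd c - d" "2 * \<bar>d\<bar> < int CARD('p)"
    using balanced_residue[OF assms(1)] by blast
  have "pnorm CARD('p) (of_int (c - d)) < 1"
    using d by (simp only: pnorm_of_int_less_1[OF prime_card])
  hence 3: "padic_norm (of_rat (of_int (c - d)) :: 'p padic) < 1" by (simp only: padic_norm_of_rat)
  have 2: "padic_norm (of_rat (r - of_int c) :: 'p padic) < 1" using c by (simp only: padic_norm_of_rat)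
  have "padic_norm ((x - of_rat r) + of_rat (r - of_int c)) < 1"
    using padic_norm_add_le_max[of "x - of_rat r" "of_rat (r - of_int c)"] r 2 by linarith
  hence "padic_norm ((x - of_rat r) + of_rat (r - of_int c) + of_rat (of_int (c - d))) < 1"
    using padic_norm_add_le_max[of "(x - of_rat r) + of_rat (r - of_int c)" "of_rat (of_int (c - d))"] 3
    by linarith
  hence "padic_norm (x - of_int d) < 1" by (simp add: of_rat_diff)
  thus ?thesis using d padic_norm_less_1_imp_le by blast
qed

lemma browkin_expansion_exists:
  fixes \<alpha> :: "'p::prime_card padic"
  assumes odd: "odd CARD('p)"
  shows "\<exists>k x. browkin_expansion \<alpha> k x"
proof -
  let ?p = "of_nat CARD('p) :: 'p padic"
  have p1: "real CARD('p) > 1" using p_gt_1[OF prime_card] .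
  \<comment> \<open>Multiplication by p ^ t moves \<alpha> into the unit ball, so the digits may
    start at exponent -t, possibly with leading zeros.\<close>
  obtain t where t: "padic_norm \<alpha> < real CARD('p) ^ t" using real_arch_pow[OF p1] by blast
  define k where "k = - int t"
  define dig where "dig y = (SOME d. 2 * \<bar>d\<bar> < int CARD('p) \<and>
    padic_norm (y - of_int d) \<le> 1 / real CARD('p))" for y :: "'p padic"
  \<comment> \<open>\<open>g n\<close> is what remains of \<alpha> after n digits, rescaled into the
    unit ball.\<close>
  define g where "g = rec_nat (\<alpha> * ?p ^ t) (\<lambda>_ y. (y - of_int (dig y)) / ?p)"
  have g0: "g 0 = \<alpha> * ?p ^ t" and gS: "g (Suc n) = (g n - of_int (dig (g n))) / ?p" for n
    by (simp_all add: g_def)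
  have dig: "2 * \<bar>dig y\<bar> < int CARD('p) \<and> padic_norm (y - of_int (dig y)) \<le> 1 / real CARD('p)"
    if "padic_norm y \<le> 1" for y
    unfolding dig_def using balanced_digit_exists[OF odd that] by (rule someI_ex)
  have g: "padic_norm (g n) \<le> 1" for n
  proof (induction n)
    case 0
    show ?case using t p1
      by (simp add: g0 padic_norm_mult padic_norm_power padic_norm_card power_divide)
  next
    case (Suc n)
    show ?case using dig[OF Suc] p1
      by (simp add: gS padic_norm_divide padic_norm_card field_simps)
  qed
  define x where "x j = dig (g (nat (j - k)))" for j
  have p0: "?p \<noteq> 0" by simp
  \<comment> \<open>The error of the n-th partial sum is exactly \<open>g n\<close> placed at
    exponent k + n; as \<open>g n\<close> stays bounded, the error tends to 0.\<close>
  have eq: "\<alpha> - (\<Sum>i<n. of_int (x (k + int i)) * ?p powi (k + int i)) = g n * ?p powi (k + int n)" for n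
  proof (induction n)
    case 0
    show ?case using p0 by (simp add: g0 k_def power_int_minus field_simps)
  next
    case (Suc n)
    have *: "g n = of_int (dig (g n)) + ?p * g (Suc n)" using p0 by (simp add: gS)
    have "\<alpha> - (\<Sum>i<Suc n. of_int (x (k + int i)) * ?p powi (k + int i))
        = g n * ?p powi (k + int n) - of_int (dig (g n)) * ?p powi (k + int n)"
      using Suc by (simp add: x_def algebra_simps)
    also have "\<dots> = g (Suc n) * (?p powi (k + int n) * ?p)"
      by (subst (1) *) (simp add: algebra_simps)
    also have "?p powi (k + int n) * ?p = ?p powi (k + int (Suc n))"
      using p0 power_int_add_1[of ?p "k + int n"] by (simp add: add_ac)
    finally show ?case .
  qed
  have "(\<lambda>n. \<Sum>i<n. of_int (x (k + int i)) * ?p powi (k + int i)) \<longlonglongrightarrow> \<alpha>"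
  proof (rule metric_LIMSEQ_I)
    fix e :: real assume e: "e > 0"
    have "(1 / real CARD('p)) < 1" "0 \<le> 1 / real CARD('p)" using p1 by simp_all
    moreover have "0 < e / real CARD('p) ^ t" using e p1 by simp
    ultimately obtain N where N: "(1 / real CARD('p)) ^ N < e / real CARD('p) ^ t"
      using real_arch_pow_inv by blast
    show "\<exists>N. \<forall>n\<ge>N. dist (\<Sum>i<n. of_int (x (k + int i)) * ?p powi (k + int i)) \<alpha> < e"
    proof (intro exI allI impI)
      fix n assume n: "n \<ge> N"
      have "dist (\<Sum>i<n. of_int (x (k + int i)) * ?p powi (k + int i)) \<alpha>
          = padic_norm (g n) * real CARD('p) powi (- (k + int n))"
        by (simp add: dist_padic_def padic_norm_minus_commute[of _ \<alpha>] eq padic_norm_mult padic_norm_card_powi)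
      also have "\<dots> \<le> 1 * real CARD('p) powi (- (k + int n))"
        using g p1 by (intro mult_right_mono) auto
      also have "\<dots> = real CARD('p) ^ t * (1 / real CARD('p)) ^ n"
        using p1 by (simp add: k_def power_int_diff power_divide)
      also have "\<dots> \<le> real CARD('p) ^ t * (1 / real CARD('p)) ^ N"
        using n p1 by (intro mult_left_mono power_decreasing) auto
      also have "\<dots> < e" using N p1 by (simp add: field_simps)
      finally show "dist (\<Sum>i<n. of_int (x (k + int i)) * ?p powi (k + int i)) \<alpha> < e" .
    qed
  qed
  moreover have "- (real CARD('p) / 2) < of_int (x j) \<and> of_int (x j) < real CARD('p) / 2" for j
  proof -
    have "2 * \<bar>x j\<bar> < int CARD('p)" using dig[OF g] by (simp add: x_def)
    hence "real_of_int (2 * \<bar>x j\<bar>) < real_of_int (int CARD('p))" by (simp only: of_int_less_iff)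
    thus ?thesis by (simp add: abs_if split: if_splits)
  qed
  ultimately show ?thesis unfolding browkin_expansion_def sums_def by blast
qed

lemma of_rat_power_int: "of_rat (q powi j) = (of_rat q powi j :: 'a::field_char_0)"
  by (simp add: power_int_def of_rat_power of_rat_inverse)

text \<open>These three properties determine the truncation, as \<open>p_integer_eqI\<close> shows,
  so later arguments need not return to digits. The norm estimate holds because only exponents of at
  least 1 are cut off.\<close>

lemma browkin_truncation:
  fixes \<alpha> :: "'p::prime_card padic"
  assumes odd: "odd CARD('p)" and ex: "browkin_expansion \<alpha> k x"
    and q: "q = (\<Sum>j=k..0. of_int (x j) * of_nat CARD('p) powi j)"
  shows "p_integer CARD('p) q" "\<bar>real_of_rat q\<bar> < real CARD('p) / 2" "padic_norm (\<alpha> - of_rat q) < 1"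
proof -
  let ?p = "real CARD('p)"
  have p1: "?p > 1" using p_gt_1[OF prime_card] .
  show "p_integer CARD('p) q" unfolding q
    by (intro p_integer_sum p_integer_mult p_integer_powi p_integer_Ints) auto
  \<comment> \<open>The number of exponents from k up to 0; \<open>nat\<close> makes it 0 for k > 0,
    where the truncation is an empty sum.\<close>
  define m where "m = nat (1 - k)"
  have img: "{k..0} = (\<lambda>i. k + int i) ` {..<m}"
  proof -
    have "j \<in> (\<lambda>i. k + int i) ` {..<m}" if "j \<in> {k..0}" for j
      using that by (intro image_eqI[of _ _ "nat (j - k)"]) (auto simp: m_def)
    thus ?thesis by (auto simp: m_def)
  qed
  have qm: "q = (\<Sum>i<m. of_int (x (k + int i)) * of_nat CARD('p) powi (k + int i))"
    unfolding q img by (subst sum.reindex) (auto simp: inj_on_def)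
  have dig: "2 * \<bar>real_of_int (x (k + int i))\<bar> \<le> ?p - 1" for i
  proof -
    have "- (?p / 2) < of_int (x (k + int i))" "of_int (x (k + int i)) < ?p / 2"
      using ex by (auto simp: browkin_expansion_def)
    hence "real_of_int (2 * \<bar>x (k + int i)\<bar>) < real_of_int (int CARD('p))" by simp
    hence "2 * \<bar>x (k + int i)\<bar> < int CARD('p)" by (simp only: of_int_less_iff)
    hence "2 * \<bar>x (k + int i)\<bar> \<le> int CARD('p) - 1" by simp
    hence "real_of_int (2 * \<bar>x (k + int i)\<bar>) \<le> real_of_int (int CARD('p) - 1)" by (simp only: of_int_le_iff)
    thus ?thesis by simp
  qed
  \<comment> \<open>The sum telescopes. Doubled digits are at most p - 1 in absolute value, so for k
    \<le> 0 the doubled truncation is at most p - p^k, strictly below p.\<close>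
  have geo: "(\<Sum>i<n. (?p - 1) * ?p powi (k + int i)) = ?p powi (k + int n) - ?p powi k" for n
  proof (induction n)
    case (Suc n)
    have "?p powi (k + int (Suc n)) = ?p powi (k + int n) * ?p"
      using p1 power_int_add_1[of ?p "k + int n"] by (simp add: add_ac)
    thus ?case using Suc by (simp add: algebra_simps)
  qed simp
  have "2 * \<bar>real_of_rat q\<bar> \<le> (\<Sum>i<m. 2 * \<bar>real_of_int (x (k + int i)) * ?p powi (k + int i)\<bar>)"
    unfolding qm sum_distrib_left[symmetric]
    by (simp add: of_rat_sum of_rat_mult of_rat_power_int sum_abs)
  also have "\<dots> \<le> (\<Sum>i<m. (?p - 1) * ?p powi (k + int i))"
  proof (intro sum_mono)
    fix i
    show "2 * \<bar>real_of_int (x (k + int i)) * ?p powi (k + int i)\<bar> \<le> (?p - 1) * ?p powi (k + int i)"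
      using mult_right_mono[OF dig[of i], of "?p powi (k + int i)"] p1 by (simp add: abs_mult)
  qed
  also have "\<dots> < ?p"
  proof (cases "k \<le> 0")
    case True
    hence "k + int m = 1" by (simp add: m_def)
    moreover have "?p powi k > 0" using p1 by simp
    ultimately show ?thesis by (simp add: geo)
  qed (use p1 in \<open>simp add: m_def\<close>)
  finally show "\<bar>real_of_rat q\<bar> < ?p / 2" by simp
  let ?S = "\<lambda>n. \<Sum>i<n. of_int (x (k + int i)) * of_nat CARD('p) powi (k + int i) :: 'p padic"
  have "?S \<longlonglongrightarrow> \<alpha>" using ex by (simp add: browkin_expansion_def sums_def)
  from metric_LIMSEQ_D[OF this, of 1] obtain N where N: "\<forall>n\<ge>N. dist (?S n) \<alpha> < 1" by auto
  \<comment> \<open>Past N the partial sum is close to \<alpha>; past m it contains the whole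
    truncation.\<close>
  define n where "n = max N m"
  have "dist (?S n) \<alpha> < 1" using N by (simp add: n_def)
  hence 1: "padic_norm (\<alpha> - ?S n) < 1" by (simp add: dist_padic_def padic_norm_minus_commute)
  have "?S n - of_rat q = ?S n - ?S m"
    by (simp add: qm of_rat_sum of_rat_mult of_rat_power_int)
  also have "\<dots> = sum (\<lambda>i. of_int (x (k + int i)) * of_nat CARD('p) powi (k + int i)) {m..<n}"
    by (subst sum_diff_nat_ivl[of 0 m n, symmetric]) (auto simp: n_def lessThan_atLeast0)
  finally have eq: "?S n - of_rat q = \<dots>" .
  have "padic_norm (?S n - of_rat q) \<le> 1 / ?p" unfolding eq
  proof (intro padic_norm_sum_le_bound)
    fix i assume "i \<in> {m..<n}"
    hence i: "k + int i \<ge> 1" by (auto simp: m_def)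
    have "padic_norm (of_int (x (k + int i)) * of_nat CARD('p) powi (k + int i) :: 'p padic)
        \<le> 1 * ?p powi (- (k + int i))"
      unfolding padic_norm_mult padic_norm_card_powi
      using p1 padic_norm_of_int_le_1 by (intro mult_right_mono) auto
    also have "\<dots> \<le> ?p powi (-1)" using i p1 unfolding mult_1 by (intro power_int_increasing) auto
    finally show "padic_norm (of_int (x (k + int i)) * of_nat CARD('p) powi (k + int i) :: 'p padic) \<le> 1 / ?p"
      by (simp add: power_int_minus field_simps)
  qed simp
  also have "\<dots> < 1" using p1 by simp
  finally show "padic_norm (\<alpha> - of_rat q) < 1"
    using 1 padic_norm_add_le_max[of "\<alpha> - ?S n" "?S n - of_rat q"] by simp
qed

text \<open>Product formula for the difference: norm at most 1/p against real size below p gives a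
  product below 1, so the difference vanishes.\<close>

lemma p_integer_eqI:
  assumes p: "prime p" and "p_integer p q" "p_integer p r"
    and "\<bar>real_of_rat q\<bar> < real p / 2" "\<bar>real_of_rat r\<bar> < real p / 2" and "pnorm p (q - r) < 1"
  shows "q = r"
proof (rule ccontr)
  assume "q \<noteq> r"
  hence "1 \<le> pnorm p (q - r) * \<bar>real_of_rat (q - r)\<bar>"
    using assms by (intro p_integer_norm_ge_1 p_integer_diff) auto
  also have "\<dots> \<le> (1 / real p) * \<bar>real_of_rat (q - r)\<bar>"
    using pnorm_less_1_imp_le[OF p assms(6)] by (intro mult_right_mono) auto
  also have "\<dots> < (1 / real p) * real p"
    using prime_gt_0_nat[OF p]
  proof (intro mult_strict_left_mono)
    show "\<bar>real_of_rat (q - r)\<bar> < real p" using assms(4,5) unfolding of_rat_diff by linarith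
  qed simp
  finally show False using prime_gt_0_nat[OF p] by simp
qed

text \<open>Existence of an expansion and uniqueness of its truncation show that the description
  defining \<open>browkin_s\<close> is definite; the properties then carry over.\<close>

lemma browkin_s:
  fixes \<alpha> :: "'p::prime_card padic"
  assumes odd: "odd CARD('p)"
  shows "p_integer CARD('p) (browkin_s \<alpha>)" "\<bar>real_of_rat (browkin_s \<alpha>)\<bar> < real CARD('p) / 2"
    "padic_norm (\<alpha> - of_rat (browkin_s \<alpha>)) < 1"
proof -
  let ?P = "\<lambda>q :: rat. \<exists>k x. browkin_expansion \<alpha> k x \<and>
                   q = (\<Sum>j=k..0. of_int (x j) * of_nat CARD('p) powi j)"
  have P: "p_integer CARD('p) q \<and> \<bar>real_of_rat q\<bar> < real CARD('p) / 2 \<and> padic_norm (\<alpha> - of_rat q) < 1"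
    if "?P q" for q
  proof -
    from that obtain k x where "browkin_expansion \<alpha> k x"
      "q = (\<Sum>j=k..0. of_int (x j) * of_nat CARD('p) powi j)" by (elim exE conjE)
    from browkin_truncation[OF odd this] show ?thesis by (intro conjI)
  qed
  have "\<exists>!q. ?P q"
  proof (rule ex_ex1I)
    obtain k x where "browkin_expansion \<alpha> k x" using browkin_expansion_exists[OF odd, of \<alpha>] by (elim exE)
    thus "\<exists>q. ?P q" by blast
  next
    fix q r assume "?P q" "?P r"
    note qr = P[OF this(1)] P[OF this(2)]
    have "padic_norm ((\<alpha> - of_rat r) - (\<alpha> - of_rat q)) < 1"
      using qr padic_norm_diff_le_max[of "\<alpha> - of_rat r" "\<alpha> - of_rat q"] by linarith
    hence "padic_norm (of_rat (q - r) :: 'p padic) < 1" by (simp add: of_rat_diff)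
    hence "pnorm CARD('p) (q - r) < 1" by (simp only: padic_norm_of_rat)
    with qr show "q = r" by (intro p_integer_eqI[OF prime_card]) auto
  qed
  hence "?P (browkin_s \<alpha>)" unfolding browkin_s_def by (rule theI')
  thus "p_integer CARD('p) (browkin_s \<alpha>)" "\<bar>real_of_rat (browkin_s \<alpha>)\<bar> < real CARD('p) / 2"
    "padic_norm (\<alpha> - of_rat (browkin_s \<alpha>)) < 1"
    using P[of "browkin_s \<alpha>"] by simp_all
qed

section \<open>Bivariate polynomials at \<open>p\<close>-adic and rational points\<close>

lemma poly_sum_le_degree:
  fixes p :: "'a::comm_semiring_1 poly"
  assumes "degree p \<le> n"
  shows "poly p x = (\<Sum>i\<le>n. coeff p i * x ^ i)"
  unfolding poly_altdef using assms
  by (intro sum.mono_neutral_left) (auto simp: coeff_eq_0)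

text \<open>One bound D for both variables gives a square double sum, a shape in which p-adic and
  rational evaluation can be compared term by term.\<close>

lemma eval2_sum:
  fixes x y :: "'a::field_char_0"
  assumes "degree F \<le> D" "\<And>i. degree (coeff F i) \<le> D"
  shows "eval2 F x y = (\<Sum>i\<le>D. \<Sum>j\<le>D. of_rat (coeff (coeff F i) j) * x ^ j * y ^ i)"
proof -
  let ?f = "\<lambda>c. poly (map_poly of_rat c) x"
  have "?f c = (\<Sum>j\<le>D. of_rat (coeff c j) * x ^ j)" if "degree c \<le> D" for c
    using poly_sum_le_degree[OF order_trans[OF degree_map_poly_le that], of of_rat x]
    by (simp add: coeff_map_poly)
  moreover have "eval2 F x y = (\<Sum>i\<le>D. ?f (coeff F i) * y ^ i)"
    unfolding eval2_def
    using poly_sum_le_degree[OF order_trans[OF degree_map_poly_le assms(1)], of ?f y]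
    by (simp add: coeff_map_poly)
  ultimately show ?thesis using assms(2) by (simp add: sum_distrib_right)
qed

lemma coeff_degree_bound:
  fixes F :: "rat poly poly"
  obtains D where "degree F \<le> D" "\<And>i. degree (coeff F i) \<le> D"
proof -
  define D where "D = max (degree F) (Max ((\<lambda>i. degree (coeff F i)) ` {..degree F}))"
  have "degree (coeff F i) \<le> D" for i
  proof (cases "i \<le> degree F")
    case True
    thus ?thesis unfolding D_def by (intro max.coboundedI2 Max_ge) auto
  qed (simp add: coeff_eq_0)
  moreover have "degree F \<le> D" by (simp add: D_def)
  ultimately show ?thesis using that by blast
qed

lemma eval2_of_rat: "eval2 F (of_rat x) (of_rat y) = (of_rat (eval2 F x y) :: 'a::field_char_0)"
proof -
  obtain D where "degree F \<le> D" "\<And>i. degree (coeff F i) \<le> D" using coeff_degree_bound by blast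
  thus ?thesis by (simp add: eval2_sum of_rat_sum of_rat_mult of_rat_power)
qed

text \<open>Product rule for errors. Writing them as multiples of a common d gives the product an
  error of the same form, so the rule iterates over powers and mixed monomials.\<close>

lemma padic_norm_diff_mult_le:
  fixes x y u v :: "'p::prime_card padic"
  assumes "padic_norm (x - u) \<le> R * d" "padic_norm (y - v) \<le> S * d"
    and "padic_norm u \<le> R" "padic_norm y \<le> S" "0 \<le> d"
  shows "padic_norm (x * y - u * v) \<le> R * S * d"
proof -
  have RS: "0 \<le> R" "0 \<le> S" using assms(3,4) padic_norm_nonneg order_trans by blast+
  have "x * y - u * v = (x - u) * y + u * (y - v)" by (simp add: algebra_simps)
  hence "padic_norm (x * y - u * v)
      \<le> max (padic_norm (x - u) * padic_norm y) (padic_norm u * padic_norm (y - v))"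
    using padic_norm_add_le_max[of "(x - u) * y" "u * (y - v)"] by (simp add: padic_norm_mult)
  moreover have "padic_norm (x - u) * padic_norm y \<le> (R * d) * S"
    using assms RS by (intro mult_mono) auto
  moreover have "padic_norm u * padic_norm (y - v) \<le> R * (S * d)"
    using assms RS by (intro mult_mono) auto
  ultimately show ?thesis by (simp add: mult_ac)
qed

text \<open>The ultrametric inequality avoids the factor n of the real estimate; 1 \<le> R permits
  the exponent n in place of n - 1.\<close>

lemma padic_norm_diff_power_le:
  fixes x u :: "'p::prime_card padic"
  assumes "padic_norm x \<le> R" "padic_norm u \<le> R" "1 \<le> R"
  shows "padic_norm (x ^ n - u ^ n) \<le> R ^ n * padic_norm (x - u)"
proof (induction n)
  case (Suc n)
  have "padic_norm (x * x ^ n - u * u ^ n) \<le> R * R ^ n * padic_norm (x - u)"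
  proof (rule padic_norm_diff_mult_le)
    show "padic_norm (x - u) \<le> R * padic_norm (x - u)"
      using assms(3) mult_right_mono[of 1 R "padic_norm (x - u)"] by simp
    show "padic_norm (x ^ n) \<le> R ^ n"
      using assms by (simp add: padic_norm_power power_mono)
  qed (use Suc assms in auto)
  thus ?case by simp
qed simp

text \<open>Lipschitz bound on a ball, obtained monomial by monomial. It converts the error of the
  convergents into smallness of F at the convergents.\<close>

lemma eval2_padic_lipschitz:
  fixes F :: "rat poly poly"
  assumes R: "1 \<le> R"
  shows "\<exists>M\<ge>0. \<forall>x y u v :: 'p::prime_card padic. padic_norm x \<le> R \<longrightarrow> padic_norm y \<le> R \<longrightarrow>
    padic_norm u \<le> R \<longrightarrow> padic_norm v \<le> R \<longrightarrow>
    padic_norm (eval2 F x y - eval2 F u v) \<le> M * max (padic_norm (x - u)) (padic_norm (y - v))"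
proof -
  obtain D where D: "degree F \<le> D" "\<And>i. degree (coeff F i) \<le> D" using coeff_degree_bound by blast
  let ?c = "\<lambda>i j. of_rat (coeff (coeff F i) j) :: 'p padic"
  define M where "M = (\<Sum>i\<le>D. \<Sum>j\<le>D. padic_norm (?c i j) * (R ^ j * R ^ i))"
  have "padic_norm (eval2 F x y - eval2 F u v) \<le> M * max (padic_norm (x - u)) (padic_norm (y - v))"
    if b: "padic_norm x \<le> R" "padic_norm y \<le> R" "padic_norm u \<le> R" "padic_norm v \<le> R"
    for x y u v :: "'p padic"
  proof -
    let ?d = "max (padic_norm (x - u)) (padic_norm (y - v))"
    have mono: "padic_norm (x ^ j * y ^ i - u ^ j * v ^ i) \<le> R ^ j * R ^ i * ?d" for i j
    proof (rule padic_norm_diff_mult_le)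
      show "padic_norm (x ^ j - u ^ j) \<le> R ^ j * ?d"
        using R b by (intro order_trans[OF padic_norm_diff_power_le[of _ R]] mult_left_mono) auto
      show "padic_norm (y ^ i - v ^ i) \<le> R ^ i * ?d"
        using R b by (intro order_trans[OF padic_norm_diff_power_le[of _ R]] mult_left_mono) auto
    qed (use b R in \<open>auto simp: padic_norm_power le_max_iff_disj intro: power_mono\<close>)
    have "eval2 F x y - eval2 F u v
        = (\<Sum>i\<le>D. \<Sum>j\<le>D. ?c i j * (x ^ j * y ^ i - u ^ j * v ^ i))"
      by (simp add: eval2_sum[OF D] sum_subtractf[symmetric] algebra_simps)
    also have "padic_norm \<dots> \<le> (\<Sum>i\<le>D. \<Sum>j\<le>D. padic_norm (?c i j * (x ^ j * y ^ i - u ^ j * v ^ i)))"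
      by (intro order_trans[OF padic_norm_sum_le] sum_mono padic_norm_sum_le)
    also have "\<dots> \<le> (\<Sum>i\<le>D. \<Sum>j\<le>D. padic_norm (?c i j) * (R ^ j * R ^ i * ?d))"
      unfolding padic_norm_mult[of "of_rat _"] by (intro sum_mono mult_left_mono mono) auto
    also have "\<dots> = M * ?d" by (simp add: M_def sum_distrib_right mult.assoc)
    finally show ?thesis .
  qed
  moreover have "M \<ge> 0" unfolding M_def using R by (intro sum_nonneg mult_nonneg_nonneg) auto
  ultimately show ?thesis by blast
qed

section \<open>Clearing denominators\<close>

lemma common_denominator:
  assumes "finite (S :: rat set)"
  shows "\<exists>L :: int. L \<noteq> 0 \<and> (\<forall>c\<in>S. of_int L * c \<in> \<int>)"
  using assms
proof (induction S)
  case (insert c S)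
  then obtain L :: int where L: "L \<noteq> 0" "\<forall>c\<in>S. of_int L * c \<in> \<int>" by blast
  obtain a b where ab: "quotient_of c = (a, b)" by fastforce
  have b: "b > 0" using quotient_of_denom_pos[OF ab] .
  have "of_int b * c = of_int a" using quotient_of_div[OF ab] b by simp
  hence "of_int L * (of_int b * c) \<in> \<int>" by simp
  moreover have "of_int b * (of_int L * d) \<in> \<int>" if "d \<in> S" for d
    by (intro Ints_mult[OF _ L(2)[rule_format, OF that]]) simp
  ultimately show ?case using L(1) b
    by (intro exI[of _ "L * b"]) (auto simp: mult_ac)
qed (auto intro: exI[of _ 1])

text \<open>Clear denominators in \<open>F(A/C, B/C)\<close> and apply the product formula to the result.\<close>

lemma eval2_liouville:
  fixes F :: "rat poly poly"
  assumes p: "prime p"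
  shows "\<exists>M>0. \<exists>E. \<forall>A B C H. p_integer p A \<longrightarrow> p_integer p B \<longrightarrow> p_integer p C \<longrightarrow> C \<noteq> 0 \<longrightarrow>
    \<bar>real_of_rat A\<bar> \<le> H \<longrightarrow> \<bar>real_of_rat B\<bar> \<le> H \<longrightarrow> \<bar>real_of_rat C\<bar> \<le> H \<longrightarrow>
    eval2 F (A / C) (B / C) \<noteq> 0 \<longrightarrow>
    1 \<le> M * (H * pnorm p C) ^ E * pnorm p (eval2 F (A / C) (B / C))"
proof -
  obtain D where D: "degree F \<le> D" "\<And>i. degree (coeff F i) \<le> D" using coeff_degree_bound by blast
  let ?c = "\<lambda>i j. coeff (coeff F i) j"
  have "finite ((\<lambda>(i, j). ?c i j) ` ({..D} \<times> {..D}))" by simp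
  from common_denominator[OF this] obtain L :: int
    where L: "L \<noteq> 0" "\<And>i j. i \<le> D \<Longrightarrow> j \<le> D \<Longrightarrow> of_int L * ?c i j \<in> \<int>" by auto
  \<comment> \<open>Every monomial has total degree at most 2 * D, so this power of C clears all
    denominators.\<close>
  define E where "E = 2 * D"
  define M where "M = 1 + (\<Sum>i\<le>D. \<Sum>j\<le>D. \<bar>real_of_rat (of_int L * ?c i j)\<bar>)"
  have "M > 0" unfolding M_def by (intro add_pos_nonneg sum_nonneg) auto
  moreover have "1 \<le> M * (H * pnorm p C) ^ E * pnorm p (eval2 F (A / C) (B / C))"
    if int: "p_integer p A" "p_integer p B" "p_integer p C" and C: "C \<noteq> 0"
      and H: "\<bar>real_of_rat A\<bar> \<le> H" "\<bar>real_of_rat B\<bar> \<le> H" "\<bar>real_of_rat C\<bar> \<le> H"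
      and nz: "eval2 F (A / C) (B / C) \<noteq> 0" for A B C H
  proof -
    have H0: "H \<ge> 0" using H(1) by linarith
    define z where "z = of_int L * C ^ E * eval2 F (A / C) (B / C)"
    have monom: "C ^ E * ((A / C) ^ j * (B / C) ^ i) = A ^ j * B ^ i * C ^ (E - i - j)"
      if "i \<le> D" "j \<le> D" for i j
    proof -
      have "E = (E - i - j) + i + j" using that by (simp add: E_def)
      hence "C ^ E = C ^ (E - i - j) * C ^ i * C ^ j" by (metis power_add)
      thus ?thesis using C by (simp add: power_divide)
    qed
    have "z = (\<Sum>i\<le>D. \<Sum>j\<le>D. (of_int L * ?c i j) * (C ^ E * ((A / C) ^ j * (B / C) ^ i)))"
      by (simp add: z_def eval2_sum[OF D] sum_distrib_left mult_ac)
    also have "\<dots> = (\<Sum>i\<le>D. \<Sum>j\<le>D. (of_int L * ?c i j) * (A ^ j * B ^ i * C ^ (E - i - j)))"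
      using monom by (intro sum.cong refl) simp
    finally have z: "z = \<dots>" .
    have "p_integer p z" unfolding z
      by (intro p_integer_sum p_integer_mult p_integer_power int p_integer_Ints[OF L(2)]) auto
    moreover have "z \<noteq> 0" using nz C L(1) by (simp add: z_def)
    ultimately have "1 \<le> pnorm p z * \<bar>real_of_rat z\<bar>" by (rule p_integer_norm_ge_1[OF p])
    \<comment> \<open>The integer factor L has norm at most 1 and is dropped p-adically; for the
      real size, each term is a product of E factors of size at most H.\<close>
    also have "\<dots> \<le> (pnorm p C ^ E * pnorm p (eval2 F (A / C) (B / C))) * (M * H ^ E)"
    proof (intro mult_mono)
      have "pnorm p z = pnorm p (of_int L) * (pnorm p C ^ E * pnorm p (eval2 F (A / C) (B / C)))"
        by (simp add: z_def pnorm_mult[OF p] pnorm_power[OF p])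
      also have "\<dots> \<le> 1 * (pnorm p C ^ E * pnorm p (eval2 F (A / C) (B / C)))"
        by (intro mult_right_mono pnorm_of_int_le_1[OF p]) (simp add: pnorm_nonneg[OF p])
      finally show "pnorm p z \<le> pnorm p C ^ E * pnorm p (eval2 F (A / C) (B / C))" by simp
      have "\<bar>real_of_rat z\<bar> \<le> (\<Sum>i\<le>D. \<Sum>j\<le>D. \<bar>real_of_rat ((of_int L * ?c i j) * (A ^ j * B ^ i * C ^ (E - i - j)))\<bar>)"
        unfolding z of_rat_sum by (intro order_trans[OF sum_abs] sum_mono sum_abs)
      also have "\<dots> \<le> (\<Sum>i\<le>D. \<Sum>j\<le>D. \<bar>real_of_rat (of_int L * ?c i j)\<bar> * H ^ E)"
      proof (intro sum_mono)
        fix i j assume ij: "i \<in> {..D}" "j \<in> {..D}"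
        have "\<bar>real_of_rat A\<bar> ^ j * \<bar>real_of_rat B\<bar> ^ i * \<bar>real_of_rat C\<bar> ^ (E - i - j)
            \<le> H ^ j * H ^ i * H ^ (E - i - j)"
          using H H0 by (intro mult_mono power_mono) auto
        also have "\<dots> = H ^ E" using ij by (simp add: E_def flip: power_add)
        finally show "\<bar>real_of_rat ((of_int L * ?c i j) * (A ^ j * B ^ i * C ^ (E - i - j)))\<bar>
            \<le> \<bar>real_of_rat (of_int L * ?c i j)\<bar> * H ^ E"
          unfolding of_rat_mult[of "of_int L * ?c i j"] abs_mult[of "of_rat (of_int L * ?c i j)"]
          by (intro mult_left_mono) (auto simp: of_rat_mult of_rat_power abs_mult power_abs)
      qed
      also have "\<dots> = (M - 1) * H ^ E" by (simp add: M_def sum_distrib_right)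
      also have "\<dots> \<le> M * H ^ E" using H0 by (intro mult_right_mono) auto
      finally show "\<bar>real_of_rat z\<bar> \<le> M * H ^ E" .
    qed (auto simp: pnorm_nonneg[OF p])
    finally show ?thesis by (simp add: power_mult_distrib mult_ac)
  qed
  ultimately show ?thesis by blast
qed

section \<open>Convergents of the Jacobi--Perron algorithm\<close>

lemma pnorm_add_eq:
  assumes p: "prime p" and less: "pnorm p y < pnorm p x"
  shows "pnorm p (x + y) = pnorm p x"
  using pnorm_add[OF p, of x y] pnorm_diff[OF p, of "x + y" y] less by auto

text \<open>Collects what holds for every infinite expansion; the limit hypotheses enter in
  \<open>limits_imp_fast\<close>.\<close>

locale padic_mcf =
  fixes \<alpha> \<beta> :: "'p::prime_card padic"
  assumes odd_card: "odd CARD('p)" and infinite: "infinite_mcf \<alpha> \<beta>"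
begin

abbreviation x :: "nat \<Rightarrow> 'p padic" where "x n \<equiv> fst (jp \<alpha> \<beta> n)"
abbreviation y :: "nat \<Rightarrow> 'p padic" where "y n \<equiv> snd (jp \<alpha> \<beta> n)"
abbreviation a :: "nat \<Rightarrow> rat" where "a \<equiv> mcf_a \<alpha> \<beta>"
abbreviation b :: "nat \<Rightarrow> rat" where "b \<equiv> mcf_b \<alpha> \<beta>"

lemma card_ge_3: "real CARD('p) \<ge> 3"
proof -
  have "CARD('p) \<ge> 3" using prime_gt_1_nat[OF prime_card[where 'a = 'p]] odd_card by presburger
  thus ?thesis by simp
qed

lemma a_approx: "padic_norm (x n - of_rat (a n)) < 1"
  and b_approx: "padic_norm (y n - of_rat (b n)) < 1"
  unfolding mcf_a_def mcf_b_def by (intro browkin_s odd_card)+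

lemma y_neq_b: "y n - of_rat (b n) \<noteq> 0"
  using infinite by (simp add: infinite_mcf_def)

lemma x_Suc: "x (Suc n) * (y n - of_rat (b n)) = 1"
  using y_neq_b[of n] by (simp add: mcf_b_def split_beta Let_def)

lemma y_Suc: "y (Suc n) = (x n - of_rat (a n)) * x (Suc n)"
  by (simp add: mcf_a_def mcf_b_def split_beta Let_def)

text \<open>The complete quotient is the inverse of a truncation error, which has norm below 1 and
  is nonzero because the algorithm does not stop.\<close>

lemma norm_x_gt_1: "padic_norm (x (Suc n)) > 1"
proof -
  have pos: "padic_norm (y n - of_rat (b n)) > 0"
    using padic_norm_eq_0_iff[of "y n - of_rat (b n)"] y_neq_b[of n]
      padic_norm_nonneg[of "y n - of_rat (b n)"] by linarith
  have "padic_norm (x (Suc n)) * padic_norm (y n - of_rat (b n)) = 1"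
    using x_Suc[of n] by (simp only: padic_norm_mult[symmetric] padic_norm_1)
  hence "padic_norm (x (Suc n)) = 1 / padic_norm (y n - of_rat (b n))"
    using pos by (simp only: field_simps)
  thus ?thesis using b_approx[of n] pos by simp
qed

lemma norm_x: "padic_norm (x (Suc n)) = pnorm CARD('p) (a (Suc n))"
proof -
  have "padic_norm (x (Suc n) - of_rat (a (Suc n))) < padic_norm (x (Suc n))"
    using a_approx[of "Suc n"] norm_x_gt_1[of n] by linarith
  from padic_norm_eq_of_diff_less[OF this] show ?thesis by (simp only: padic_norm_of_rat)
qed

lemma a_gt_1: "pnorm CARD('p) (a (Suc n)) > 1"
  using norm_x_gt_1[of n] norm_x[of n] by linarith

lemma a_ge: "pnorm CARD('p) (a (Suc n)) \<ge> real CARD('p)"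
  by (rule pnorm_gt_1_imp_ge[OF prime_card a_gt_1])

lemma a_nonzero: "a (Suc n) \<noteq> 0"
  using a_gt_1[of n] pnorm_0[OF prime_card[where 'a = 'p]] by (metis not_one_less_zero)

lemma norm_y_less: "padic_norm (y (Suc n)) < padic_norm (x (Suc n))"
  unfolding y_Suc padic_norm_mult using a_approx[of n] norm_x_gt_1[of n] by simp

text \<open>Truncation changes \<open>y\<close> by less than 1, while \<open>y\<close> is smaller
  than \<open>x\<close> and \<open>x\<close> exceeds 1 in norm. This makes the \<open>a\<close> term
  dominate the recurrence.\<close>

lemma b_less_a: "pnorm CARD('p) (b (Suc n)) < pnorm CARD('p) (a (Suc n))"
proof -
  have "pnorm CARD('p) (b (Suc n)) \<le> max (padic_norm (y (Suc n))) (padic_norm (y (Suc n) - of_rat (b (Suc n))))"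
    using padic_norm_diff_le_max[of "y (Suc n)" "y (Suc n) - of_rat (b (Suc n))"]
    by (simp only: diff_diff_eq2 add_diff_cancel_left' padic_norm_of_rat)
  thus ?thesis
    using norm_y_less[of n] b_approx[of "Suc n"] norm_x_gt_1[of n] unfolding norm_x by linarith
qed

lemma norm_y_le: "padic_norm (y n) \<le> max (pnorm CARD('p) (b n)) 1"
  using padic_norm_add_le_max[of "y n - of_rat (b n)" "of_rat (b n)"] b_approx[of n]
  unfolding diff_add_cancel padic_norm_of_rat by linarith

section \<open>Real and p-adic growth of solutions of the recurrence\<close>

definition G :: "nat \<Rightarrow> real" where "G n = (\<Prod>i=1..n. pnorm CARD('p) (a i))"

lemma G_0 [simp]: "G 0 = 1" and G_Suc: "G (Suc n) = G n * pnorm CARD('p) (a (Suc n))"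
  by (simp_all add: G_def)

lemma G_ge: "G n \<ge> real CARD('p) ^ n"
proof (induction n)
  case (Suc n)
  have "real CARD('p) ^ n * real CARD('p) \<le> G n * pnorm CARD('p) (a (Suc n))"
    using Suc a_ge[of n] by (intro mult_mono order_trans[OF _ Suc]) auto
  thus ?case by (simp add: G_Suc mult_ac)
qed simp

lemma G_pos: "G n > 0"
  using G_ge[of n] card_ge_3 by (intro less_le_trans[OF _ G_ge]) auto

lemma G_less_Suc: "G n < G (Suc n)"
  unfolding G_Suc using a_gt_1[of n] G_pos[of n] by simp

abbreviation rec :: "rat \<Rightarrow> rat \<Rightarrow> rat \<Rightarrow> nat \<Rightarrow> rat" where "rec \<equiv> mcf_rec a b"

lemma rec_Suc: "rec u v w (n + 3) = a (Suc n) * rec u v w (n + 2) + b (Suc n) * rec u v w (n + 1) + rec u v w n"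
  by (simp add: eval_nat_numeral)

lemma p_integer_rec:
  assumes "p_integer CARD('p) u" "p_integer CARD('p) v" "p_integer CARD('p) w"
  shows "p_integer CARD('p) (rec u v w n)"
  using assms
  by (induction a b u v w n rule: mcf_rec.induct)
     (auto intro!: p_integer_add p_integer_mult simp: mcf_a_def mcf_b_def browkin_s[OF odd_card])

text \<open>Both coefficients have real size below p/2, so for p \<ge> 3 each step costs at most a
  factor p. The induction carries three consecutive values.\<close>

lemma rec_real_bound:
  "\<bar>real_of_rat (rec u v w n)\<bar> \<le> (\<bar>real_of_rat u\<bar> + \<bar>real_of_rat v\<bar> + \<bar>real_of_rat w\<bar>) * real CARD('p) ^ n"
proof -
  define c where "c = \<bar>real_of_rat u\<bar> + \<bar>real_of_rat v\<bar> + \<bar>real_of_rat w\<bar>"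
  let ?p = "real CARD('p)" and ?r = "\<lambda>n. \<bar>real_of_rat (rec u v w n)\<bar>"
  have c: "c \<ge> 0" by (simp add: c_def)
  have pp: "?p ^ n \<ge> 1" for n using card_ge_3 by (intro one_le_power) auto
  have "?r n \<le> c * ?p ^ n \<and> ?r (n + 1) \<le> c * ?p ^ (n + 1) \<and> ?r (n + 2) \<le> c * ?p ^ (n + 2)"
  proof (induction n)
    case 0
    have "c \<le> c * ?p ^ n" for n using mult_left_mono[OF pp c] by simp
    hence "c \<le> c * ?p ^ 0" "c \<le> c * ?p ^ 1" "c \<le> c * ?p ^ 2" by blast+
    moreover have "?r 0 \<le> c" "?r 1 \<le> c" "?r 2 \<le> c"
      by (simp_all add: c_def eval_nat_numeral)
    ultimately show ?case unfolding add_0 by linarith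
  next
    case (Suc n)
    have ab: "\<bar>real_of_rat (a (Suc n))\<bar> \<le> ?p / 2" "\<bar>real_of_rat (b (Suc n))\<bar> \<le> ?p / 2"
      unfolding mcf_a_def mcf_b_def by (intro less_imp_le browkin_s(2) odd_card)+
    have "?r (n + 3) \<le> \<bar>real_of_rat (a (Suc n))\<bar> * ?r (n + 2) + \<bar>real_of_rat (b (Suc n))\<bar> * ?r (n + 1) + ?r n"
      unfolding rec_Suc of_rat_add of_rat_mult abs_mult[symmetric] by linarith
    also have "\<dots> \<le> ?p / 2 * (c * ?p ^ (n + 2)) + ?p / 2 * (c * ?p ^ (n + 1)) + c * ?p ^ n"
      using Suc ab by (intro add_mono mult_mono) auto
    also have "\<dots> = (c * ?p ^ n) * (?p * ?p ^ 2 / 2 + ?p ^ 2 / 2 + 1)"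
      by (simp add: field_simps power2_eq_square)
    also have "\<dots> \<le> (c * ?p ^ n) * (?p * ?p ^ 2)"
    proof (intro mult_left_mono)
      have "3 * 3 \<le> ?p * ?p" using card_ge_3 by (intro mult_mono) auto
      moreover have "3 * ?p ^ 2 \<le> ?p * ?p ^ 2" using card_ge_3 by (intro mult_right_mono) auto
      ultimately show "?p * ?p ^ 2 / 2 + ?p ^ 2 / 2 + 1 \<le> ?p * ?p ^ 2"
        unfolding power2_eq_square by linarith
    qed (use c in simp)
    also have "\<dots> = c * ?p ^ (n + 3)" by (simp add: power_add eval_nat_numeral)
    finally show ?case using Suc by (simp add: eval_nat_numeral)
  qed
  thus ?thesis by (simp add: c_def)
qed

text \<open>A step costs at most the norm of \<open>a\<close>, since that of \<open>b\<close> is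
  smaller and \<open>G\<close> increases; three consecutive terms share one bound to keep the
  induction going.\<close>

lemma rec_pnorm_bound:
  assumes "pnorm CARD('p) u \<le> c" "pnorm CARD('p) v \<le> c" "pnorm CARD('p) w \<le> c"
  shows "pnorm CARD('p) (rec u v w n) \<le> c * G n \<and>
    pnorm CARD('p) (rec u v w (n + 1)) \<le> c * G n \<and>
    pnorm CARD('p) (rec u v w (n + 2)) \<le> c * G n"
proof (induction n)
  case 0
  show ?case using assms by (simp add: eval_nat_numeral)
next
  case (Suc n)
  have c: "0 \<le> c" using assms(1) pnorm_nonneg[OF prime_card, of u] by (metis order_trans)
  have le: "c * G n \<le> c * G (Suc n)" using c G_less_Suc[of n] by (intro mult_left_mono) auto
  have "pnorm CARD('p) (a (Suc n) * rec u v w (n + 2)) \<le> pnorm CARD('p) (a (Suc n)) * (c * G n)"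
    unfolding pnorm_mult[OF prime_card]
    using Suc by (intro mult_left_mono pnorm_nonneg[OF prime_card]) auto
  moreover have "pnorm CARD('p) (b (Suc n) * rec u v w (n + 1)) \<le> pnorm CARD('p) (a (Suc n)) * (c * G n)"
    unfolding pnorm_mult[OF prime_card]
    using Suc b_less_a[of n] by (intro mult_mono pnorm_nonneg[OF prime_card]) auto
  moreover have "pnorm CARD('p) (rec u v w n) \<le> c * G (Suc n)" using Suc le by linarith
  ultimately have "pnorm CARD('p) (rec u v w (n + 3)) \<le> c * G (Suc n)"
    unfolding rec_Suc G_Suc
    using pnorm_add[OF prime_card, of "a (Suc n) * rec u v w (n + 2)" "b (Suc n) * rec u v w (n + 1)", where 'a1 = 'p]
      pnorm_add[OF prime_card, of "a (Suc n) * rec u v w (n + 2) + b (Suc n) * rec u v w (n + 1)"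
        "rec u v w n", where 'a1 = 'p]
    by (auto simp: mult_ac)
  thus ?case using Suc le by (simp add: eval_nat_numeral)
qed

abbreviation Crec :: "nat \<Rightarrow> rat" where "Crec \<equiv> rec 0 0 1"

lemma Crec_pnorm_le:
  "pnorm CARD('p) (Crec n) \<le> G n" "pnorm CARD('p) (Crec (n + 1)) \<le> G n"
  "pnorm CARD('p) (Crec (n + 2)) \<le> G n"
  using rec_pnorm_bound[of 0 1 0 1 n] by (simp_all add: pnorm_0[OF prime_card] pnorm_1[OF prime_card])

text \<open>The \<open>a\<close> term is strictly larger than the other two, so nothing cancels and
  the upper bound is attained. In particular the denominators of the convergents do not
  vanish.\<close>

lemma Crec_pnorm: "pnorm CARD('p) (Crec (n + 2)) = G n"
proof (induction n)
  case 0
  show ?case by (simp add: eval_nat_numeral pnorm_1[OF prime_card])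
next
  case (Suc n)
  have main: "pnorm CARD('p) (a (Suc n) * Crec (n + 2)) = G (Suc n)"
    using Suc by (simp add: pnorm_mult[OF prime_card] G_Suc)
  have "pnorm CARD('p) (b (Suc n) * Crec (n + 1)) \<le> pnorm CARD('p) (b (Suc n)) * G n"
    unfolding pnorm_mult[OF prime_card]
    by (intro mult_left_mono pnorm_nonneg[OF prime_card] Crec_pnorm_le)
  also have "\<dots> < G (Suc n)"
    unfolding G_Suc using b_less_a[of n] G_pos[of n] by simp
  finally have 1: "pnorm CARD('p) (b (Suc n) * Crec (n + 1)) < pnorm CARD('p) (a (Suc n) * Crec (n + 2))"
    unfolding main .
  have "pnorm CARD('p) (Crec n) < G (Suc n)" using Crec_pnorm_le(1)[of n] G_less_Suc[of n] by linarith
  hence "pnorm CARD('p) (Crec (n + 3)) = G (Suc n)"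
    unfolding rec_Suc using pnorm_add_eq[OF prime_card 1] main by (subst pnorm_add_eq[OF prime_card]) auto
  thus ?case by (simp add: eval_nat_numeral)
qed

lemma Crec_nonzero: "Crec (n + 2) \<noteq> 0"
  using Crec_pnorm[of n] G_pos[of n] pnorm_0[OF prime_card[where 'a = 'p]] by (metis less_irrefl)

text \<open>
  For \<open>X = A, B, C\<close> this is \<open>\<alpha>\<^sub>n\<^sub>+\<^sub>1 X\<^sub>n + \<beta>\<^sub>n\<^sub>+\<^sub>1 X\<^sub>n\<^sub>-\<^sub>1 + X\<^sub>n\<^sub>-\<^sub>2\<close> (indices of sequences given by
  \<^const>\<open>mcf_rec\<close> are shifted by two); it equals \<open>\<alpha>\<close>, \<open>\<beta>\<close>, \<open>1\<close> times \<open>\<alpha>\<^sub>1 \<dots> \<alpha>\<^sub>n\<^sub>+\<^sub>1\<close>, respectively.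
\<close>

definition E :: "(nat \<Rightarrow> rat) \<Rightarrow> nat \<Rightarrow> 'p padic" where
  "E X n = x (Suc n) * of_rat (X (n + 2)) + y (Suc n) * of_rat (X (n + 1)) + of_rat (X n)"

text \<open>Once the recurrence is inserted, the partial quotients cancel and the new complete
  quotient factors out.\<close>

lemma E_Suc: "E (rec u v w) (Suc n) = x (Suc (Suc n)) * E (rec u v w) n"
proof -
  let ?X = "\<lambda>n. of_rat (rec u v w n) :: 'p padic"
  define s where "s = x (Suc (Suc n))"
  \<comment> \<open>The term without a complete quotient is multiplied by 1, written as s times the
    truncation error of \<open>y\<close>, so that every summand carries s.\<close>
  have 1: "?X (n + 1) = s * (y (Suc n) - of_rat (b (Suc n))) * ?X (n + 1)"
    using x_Suc[of "Suc n"] by (simp only: s_def mult_1_left)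
  have 2: "y (Suc (Suc n)) = (x (Suc n) - of_rat (a (Suc n))) * s"
    unfolding s_def by (rule y_Suc)
  have "E (rec u v w) (Suc n) = s * ?X (n + 3) + y (Suc (Suc n)) * ?X (n + 2) + ?X (n + 1)"
    by (simp add: E_def s_def eval_nat_numeral del: jp.simps mcf_rec.simps)
  also have "\<dots> = s * (of_rat (a (Suc n)) * ?X (n + 2) + of_rat (b (Suc n)) * ?X (n + 1) + ?X n)
      + (x (Suc n) - of_rat (a (Suc n))) * s * ?X (n + 2)
      + s * (y (Suc n) - of_rat (b (Suc n))) * ?X (n + 1)"
    unfolding rec_Suc of_rat_add of_rat_mult 2 1[symmetric] by (rule refl)
  also have "\<dots> = s * E (rec u v w) n"
    unfolding E_def by (simp add: algebra_simps del: jp.simps mcf_rec.simps)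
  finally show ?thesis by (simp only: s_def)
qed

text \<open>Both sides gain the same factor at each step, so their ratio is fixed at n = 0. This
  expresses \<alpha> and \<beta> exactly through the complete quotients.\<close>

lemma E_proportional:
  assumes "E (rec u v w) 0 = \<xi> * E Crec 0"
  shows "E (rec u v w) n = \<xi> * E Crec n"
  by (induction n) (simp_all only: assms E_Suc mult.left_commute)

lemma norm_E_Crec: "padic_norm (E Crec n) = G (Suc n)"
proof (induction n)
  case 0
  have "E Crec 0 = x (Suc 0)" by (simp add: E_def eval_nat_numeral del: jp.simps)
  thus ?case by (simp add: norm_x G_Suc del: jp.simps)
next
  case (Suc n)
  thus ?case unfolding E_Suc padic_norm_mult norm_x by (simp add: G_Suc mult_ac)
qed

section \<open>Approximation by convergents\<close>

definition \<delta> :: "nat \<Rightarrow> real" where "\<delta> n = max (pnorm CARD('p) (b n)) 1 / pnorm CARD('p) (a n)"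

text \<open>Multiplied by the denominator and by \<open>E Crec n\<close>, the error becomes a
  combination of two 2 by 2 minors, because the \<open>x\<close> terms cancel. The minors are at
  most \<open>c * G n * G n\<close>, and the two multipliers have norms \<open>G n\<close> and
  \<open>G (Suc n)\<close>.\<close>

lemma convergent_error:
  assumes init: "E (rec u v w) 0 = \<xi> * E Crec 0"
    and c: "pnorm CARD('p) u \<le> c" "pnorm CARD('p) v \<le> c" "pnorm CARD('p) w \<le> c"
  shows "padic_norm (\<xi> - of_rat (rec u v w (n + 2) / Crec (n + 2))) \<le> c * \<delta> (Suc n)"
proof -
  let ?X = "rec u v w" and ?m = "max (pnorm CARD('p) (b (Suc n))) 1"
  have c0: "0 \<le> c" using c(1) pnorm_nonneg[OF prime_card, of u] by (metis order_trans)
  \<comment> \<open>The minors are bounded by size alone; the indices n and n + 1 stand for n - 2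
    and n - 1 before the shift.\<close>
  have det: "padic_norm (of_rat (?X i * Crec (n + 2) - ?X (n + 2) * Crec i) :: 'p padic) \<le> c * G n * G n"
    if "i \<in> {n, n + 1}" for i
  proof -
    have X: "pnorm CARD('p) (?X i) \<le> c * G n" "pnorm CARD('p) (?X (n + 2)) \<le> c * G n"
      using that rec_pnorm_bound[OF c, of n] by auto
    have Ci: "pnorm CARD('p) (Crec i) \<le> G n" using that Crec_pnorm_le[of n] by auto
    have "pnorm CARD('p) (?X i * Crec (n + 2)) \<le> c * G n * G n"
      unfolding pnorm_mult[OF prime_card] Crec_pnorm using X G_pos[of n] by (intro mult_right_mono) auto
    moreover have "pnorm CARD('p) (?X (n + 2) * Crec i) \<le> c * G n * G n"
      unfolding pnorm_mult[OF prime_card] using X Ci G_pos[of n] c0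
      by (intro mult_mono pnorm_nonneg[OF prime_card]) auto
    ultimately show ?thesis
      unfolding padic_norm_of_rat
      using pnorm_diff[OF prime_card, of "?X i * Crec (n + 2)" "?X (n + 2) * Crec i", where 'a1 = 'p]
      by linarith
  qed
  have "(\<xi> * of_rat (Crec (n + 2)) - of_rat (?X (n + 2))) * E Crec n
      = E ?X n * of_rat (Crec (n + 2)) - of_rat (?X (n + 2)) * E Crec n"
    unfolding E_proportional[OF init, of n] by (simp only: algebra_simps)
  also have "\<dots> = y (Suc n) * of_rat (?X (n + 1) * Crec (n + 2) - ?X (n + 2) * Crec (n + 1))
      + of_rat (?X n * Crec (n + 2) - ?X (n + 2) * Crec n)"
    (is "_ = ?R") unfolding E_def of_rat_diff of_rat_mult by (simp only: algebra_simps)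
  finally have eq: "(\<xi> * of_rat (Crec (n + 2)) - of_rat (?X (n + 2))) * E Crec n = ?R" .
  have "padic_norm ?R \<le> ?m * (c * G n * G n)"
  proof (rule order_trans[OF padic_norm_add_le_max], rule max.boundedI)
    show "padic_norm (y (Suc n) * of_rat (?X (n + 1) * Crec (n + 2) - ?X (n + 2) * Crec (n + 1)))
        \<le> ?m * (c * G n * G n)"
      unfolding padic_norm_mult
      by (intro mult_mono norm_y_le det padic_norm_nonneg) (auto simp: le_max_iff_disj)
    have "1 * (c * G n * G n) \<le> ?m * (c * G n * G n)"
      using c0 G_pos[of n] by (intro mult_right_mono) auto
    with det[of n] show "padic_norm (of_rat (?X n * Crec (n + 2) - ?X (n + 2) * Crec n) :: 'p padic)
        \<le> ?m * (c * G n * G n)" by simp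
  qed
  hence main: "padic_norm (\<xi> * of_rat (Crec (n + 2)) - of_rat (?X (n + 2))) * G (Suc n)
      \<le> ?m * (c * G n * G n)"
    unfolding eq[symmetric] padic_norm_mult norm_E_Crec .
  have "\<xi> * of_rat (Crec (n + 2)) - of_rat (?X (n + 2))
      = (\<xi> - of_rat (?X (n + 2) / Crec (n + 2))) * of_rat (Crec (n + 2))"
    using Crec_nonzero[of n] unfolding of_rat_divide by (simp only: left_diff_distrib) (simp del: mcf_rec.simps)
  hence "padic_norm (\<xi> * of_rat (Crec (n + 2)) - of_rat (?X (n + 2)))
      = padic_norm (\<xi> - of_rat (?X (n + 2) / Crec (n + 2))) * G n"
    by (simp only: padic_norm_mult padic_norm_of_rat Crec_pnorm)
  with main have "padic_norm (\<xi> - of_rat (?X (n + 2) / Crec (n + 2))) * pnorm CARD('p) (a (Suc n)) * (G n * G n)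
      \<le> ?m * c * (G n * G n)"
    by (simp only: G_Suc mult_ac)
  hence "padic_norm (\<xi> - of_rat (?X (n + 2) / Crec (n + 2))) * pnorm CARD('p) (a (Suc n)) \<le> ?m * c"
    using G_pos[of n] by (simp only: mult_le_cancel_right) auto
  thus ?thesis unfolding \<delta>_def using a_gt_1[of n] by (simp add: field_simps del: mcf_rec.simps)
qed

text \<open>The first step of the algorithm, solved for \<alpha> and \<beta>, provides the starting
  case required by \<open>E_proportional\<close>.\<close>

lemma E_A_0: "E (rec 0 1 (a 0)) 0 = \<alpha> * E Crec 0"
  and E_B_0: "E (rec 1 0 (b 0)) 0 = \<beta> * E Crec 0"
proof -
  have "E Crec 0 = x (Suc 0)" by (simp add: E_def eval_nat_numeral del: jp.simps)
  moreover have "E (rec 0 1 (a 0)) 0 = x (Suc 0) * of_rat (a 0) + y (Suc 0)"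
    by (simp add: E_def eval_nat_numeral del: jp.simps)
  moreover have "E (rec 1 0 (b 0)) 0 = x (Suc 0) * of_rat (b 0) + 1"
    by (simp add: E_def eval_nat_numeral del: jp.simps)
  moreover have "y (Suc 0) = (\<alpha> - of_rat (a 0)) * x (Suc 0)" using y_Suc[of 0] by (simp only: jp.simps fst_conv)
  moreover have "x (Suc 0) * (\<beta> - of_rat (b 0)) = 1" using x_Suc[of 0] by (simp only: jp.simps snd_conv)
  ultimately show "E (rec 0 1 (a 0)) 0 = \<alpha> * E Crec 0" "E (rec 1 0 (b 0)) 0 = \<beta> * E Crec 0"
    by (simp_all add: algebra_simps del: jp.simps)
qed

text \<open>A nonzero value is bounded below by \<open>eval2_liouville\<close> and above by
  \<open>eval2_padic_lipschitz\<close> combined with \<open>convergent_error\<close>.\<close>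

lemma eval2_convergents_lower_bound:
  assumes zero: "eval2 F \<alpha> \<beta> = 0"
  shows "\<exists>M e. \<forall>n. eval2 F (Q_alpha \<alpha> \<beta> n) (Q_beta \<alpha> \<beta> n) \<noteq> 0 \<longrightarrow>
    1 \<le> M * G n ^ e * \<delta> (Suc n)"
proof -
  let ?p = "real CARD('p)"
  let ?A = "rec 0 1 (a 0)" and ?B = "rec 1 0 (b 0)"
  \<comment> \<open>c bounds the initial values p-adically, and with them all convergents; R is the
    radius of a ball holding these together with \<alpha> and \<beta>; h bounds the real sizes of
    the initial values.\<close>
  define c where "c = 1 + pnorm CARD('p) (a 0) + pnorm CARD('p) (b 0)"
  define R where "R = 1 + padic_norm \<alpha> + padic_norm \<beta> + c"
  define h where "h = 2 + \<bar>real_of_rat (a 0)\<bar> + \<bar>real_of_rat (b 0)\<bar>"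
  have nn: "pnorm CARD('p) q \<ge> 0" for q by (rule pnorm_nonneg[OF prime_card])
  have c: "c \<ge> 1" "pnorm CARD('p) 0 \<le> c" "pnorm CARD('p) 1 \<le> c"
    "pnorm CARD('p) (a 0) \<le> c" "pnorm CARD('p) (b 0) \<le> c"
    using nn[of "a 0"] nn[of "b 0"]
    by (simp_all add: c_def pnorm_0[OF prime_card] pnorm_1[OF prime_card])
  have R: "1 \<le> R" "padic_norm \<alpha> \<le> R" "padic_norm \<beta> \<le> R" "c \<le> R"
    using c(1) padic_norm_nonneg[of \<alpha>] padic_norm_nonneg[of \<beta>] by (simp_all add: R_def)
  obtain M1 where M1: "M1 \<ge> 0" "\<And>x y u v :: 'p padic. \<lbrakk>padic_norm x \<le> R; padic_norm y \<le> R;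
      padic_norm u \<le> R; padic_norm v \<le> R\<rbrakk> \<Longrightarrow>
      padic_norm (eval2 F x y - eval2 F u v) \<le> M1 * max (padic_norm (x - u)) (padic_norm (y - v))"
    using eval2_padic_lipschitz[OF R(1), of F, where 'p = 'p] by blast
  obtain M2 e where M2: "M2 > 0" "\<And>A B C H. \<lbrakk>p_integer CARD('p) A; p_integer CARD('p) B;
      p_integer CARD('p) C; C \<noteq> 0; \<bar>real_of_rat A\<bar> \<le> H; \<bar>real_of_rat B\<bar> \<le> H; \<bar>real_of_rat C\<bar> \<le> H;
      eval2 F (A / C) (B / C) \<noteq> 0\<rbrakk> \<Longrightarrow>
      1 \<le> M2 * (H * pnorm CARD('p) C) ^ e * pnorm CARD('p) (eval2 F (A / C) (B / C))"
    using eval2_liouville[OF prime_card[where 'a = 'p], of F] by blast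
  have "1 \<le> M2 * (h * ?p ^ 2) ^ e * M1 * c * G n ^ (2 * e) * \<delta> (Suc n)"
    if nz: "eval2 F (Q_alpha \<alpha> \<beta> n) (Q_beta \<alpha> \<beta> n) \<noteq> 0" for n
  proof -
    let ?C = "Crec (n + 2)"
    have int: "p_integer CARD('p) 0" "p_integer CARD('p) 1" "p_integer CARD('p) (a 0)" "p_integer CARD('p) (b 0)"
      by (simp_all add: mcf_a_def mcf_b_def browkin_s(1)[OF odd_card] p_integer_Ints)
    have QA: "Q_alpha \<alpha> \<beta> n = ?A (n + 2) / ?C" and QB: "Q_beta \<alpha> \<beta> n = ?B (n + 2) / ?C"
      by (simp_all only: Q_alpha_def Q_beta_def mcf_A_def mcf_B_def mcf_C_def)
    have H: "\<bar>real_of_rat (rec u v w (n + 2))\<bar> \<le> h * ?p ^ (n + 2)"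
      if "\<bar>real_of_rat u\<bar> + \<bar>real_of_rat v\<bar> + \<bar>real_of_rat w\<bar> \<le> h" for u v w
      by (intro order_trans[OF rec_real_bound] mult_right_mono that) simp
    have "1 \<le> M2 * (h * ?p ^ (n + 2) * pnorm CARD('p) ?C) ^ e
        * pnorm CARD('p) (eval2 F (?A (n + 2) / ?C) (?B (n + 2) / ?C))"
    proof (rule M2(2)[OF _ _ _ Crec_nonzero])
      show "p_integer CARD('p) (?A (n + 2))" "p_integer CARD('p) (?B (n + 2))" "p_integer CARD('p) ?C"
        by (intro p_integer_rec int)+
      show "\<bar>real_of_rat (?A (n + 2))\<bar> \<le> h * ?p ^ (n + 2)" "\<bar>real_of_rat (?B (n + 2))\<bar> \<le> h * ?p ^ (n + 2)"
        "\<bar>real_of_rat ?C\<bar> \<le> h * ?p ^ (n + 2)"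
        by (intro H; simp add: h_def)+
    qed (use nz QA QB in simp)
    also have "\<dots> \<le> M2 * ((h * ?p ^ 2) ^ e * G n ^ (2 * e)) * (M1 * (c * \<delta> (Suc n)))"
    proof (intro mult_mono)
      \<comment> \<open>p ^ n \<le> \<open>G n\<close> trades the real growth for a second factor
        \<open>G n\<close>, whence the exponent 2 * e.\<close>
      have "h * ?p ^ (n + 2) * pnorm CARD('p) ?C \<le> h * (?p ^ 2 * G n) * G n"
        unfolding Crec_pnorm power_add
        using G_ge[of n] G_pos[of n] by (intro mult_right_mono mult_left_mono) (auto simp: h_def mult.commute)
      hence "(h * ?p ^ (n + 2) * pnorm CARD('p) ?C) ^ e \<le> (h * (?p ^ 2 * G n) * G n) ^ e"
        using nn by (intro power_mono mult_nonneg_nonneg) (auto simp: h_def)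
      thus "(h * ?p ^ (n + 2) * pnorm CARD('p) ?C) ^ e \<le> (h * ?p ^ 2) ^ e * G n ^ (2 * e)"
        by (simp add: power_mult power_mult_distrib power2_eq_square mult_ac)
      have bd: "padic_norm (of_rat (rec u v w (n + 2) / ?C) :: 'p padic) \<le> R"
        if "pnorm CARD('p) u \<le> c" "pnorm CARD('p) v \<le> c" "pnorm CARD('p) w \<le> c" for u v w
      proof -
        have "padic_norm (of_rat (rec u v w (n + 2) / ?C) :: 'p padic) = pnorm CARD('p) (rec u v w (n + 2)) / G n"
          unfolding of_rat_divide padic_norm_divide padic_norm_of_rat Crec_pnorm ..
        also have "\<dots> \<le> c" using rec_pnorm_bound[OF that, of n] G_pos[of n] by (simp add: field_simps)
        finally show ?thesis using R by linarith
      qed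
      have "pnorm CARD('p) (eval2 F (?A (n + 2) / ?C) (?B (n + 2) / ?C))
          = padic_norm (eval2 F \<alpha> \<beta> - eval2 F (of_rat (?A (n + 2) / ?C)) (of_rat (?B (n + 2) / ?C)))"
        unfolding zero eval2_of_rat by (simp only: diff_0 padic_norm_minus padic_norm_of_rat)
      also have "\<dots> \<le> M1 * max (padic_norm (\<alpha> - of_rat (?A (n + 2) / ?C))) (padic_norm (\<beta> - of_rat (?B (n + 2) / ?C)))"
        by (intro M1(2) R bd c)
      also have "\<dots> \<le> M1 * (c * \<delta> (Suc n))"
        by (intro mult_left_mono M1(1) max.boundedI convergent_error E_A_0 E_B_0 c)
      finally show "pnorm CARD('p) (eval2 F (?A (n + 2) / ?C) (?B (n + 2) / ?C)) \<le> M1 * (c * \<delta> (Suc n))" .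
    qed (use M2(1) G_pos[of n] nn in \<open>auto simp: h_def intro!: mult_nonneg_nonneg\<close>)
    finally show ?thesis by (simp only: mult_ac)
  qed
  thus ?thesis by blast
qed

text \<open>As \<open>\<delta> (Suc n)\<close> is at least the inverse norm of
  \<open>a (Suc n)\<close>, the case T = 2 makes the norms of \<open>a\<close> at least square at
  each step. Hence \<open>G n\<close> is at most a constant times the squared norm of
  \<open>a n\<close>, and a larger T beats any power of it.\<close>

lemma rapid_growth:
  assumes fast: "\<And>T. \<forall>\<^sub>F n in sequentially. \<delta> (Suc n) * pnorm CARD('p) (a n) ^ T \<le> 1"
  shows "\<forall>\<^sub>F n in sequentially. M * G n ^ e * \<delta> (Suc n) < 1"
proof -
  let ?u = "\<lambda>n. pnorm CARD('p) (a n)"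
  have u: "?u n > 1" "?u n \<ge> real CARD('p)" if "n \<ge> 1" for n
    using that a_gt_1[of "n - 1"] a_ge[of "n - 1"] by simp_all
  have \<delta>: "\<delta> n > 0" "1 \<le> \<delta> n * ?u n" if "n \<ge> 1" for n
    using u[OF that] by (auto simp: \<delta>_def less_max_iff_disj)
  obtain N where N: "\<And>n. n \<ge> N \<Longrightarrow> \<delta> (Suc n) * ?u n ^ 2 \<le> 1"
    using fast[of 2] unfolding eventually_sequentially by blast
  define K where "K = max N 1"
  have step: "?u n ^ 2 \<le> ?u (Suc n)" if "n \<ge> K" for n
  proof -
    have "\<delta> (Suc n) * ?u n ^ 2 \<le> \<delta> (Suc n) * ?u (Suc n)"
      using N[of n] \<delta>(2)[of "Suc n"] that by (simp add: K_def)
    thus ?thesis using \<delta>(1)[of "Suc n"] by simp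
  qed
  have G: "G n \<le> G K * ?u n ^ 2" if "n \<ge> K" for n
    using that
  proof (induction n rule: dec_induct)
    case base
    have "1 \<le> ?u K ^ 2" using u(1)[of K] by (intro one_le_power) (auto simp: K_def)
    thus ?case using mult_left_mono[of 1 "?u K ^ 2" "G K"] G_pos[of K] by simp
  next
    case (step n)
    have "G (Suc n) \<le> (G K * ?u n ^ 2) * ?u (Suc n)"
      unfolding G_Suc using step u(1)[of "Suc n"] by (intro mult_right_mono) auto
    also have "\<dots> \<le> (G K * ?u (Suc n)) * ?u (Suc n)"
      using \<open>K \<le> n\<close> G_pos[of K] u(1)[of "Suc n"] \<open>\<And>n. n \<ge> K \<Longrightarrow> ?u n ^ 2 \<le> ?u (Suc n)\<close>
      by (intro mult_right_mono mult_left_mono) auto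
    finally show ?case by (simp add: power2_eq_square mult.assoc)
  qed
  \<comment> \<open>The norm of \<open>a n\<close> is at least p, so its m-th power absorbs the
    constant; T = m + 2 * e then suffices.\<close>
  obtain m where m: "\<bar>M\<bar> * G K ^ e < real CARD('p) ^ m"
    using real_arch_pow[OF p_gt_1[OF prime_card]] by blast
  show ?thesis
    using fast[of "m + 2 * e"] eventually_ge_at_top[of K]
  proof eventually_elim
    case (elim n)
    hence n: "n \<ge> 1" by (simp add: K_def)
    have "M * G n ^ e \<le> \<bar>M\<bar> * G n ^ e" using G_pos[of n] by (intro mult_right_mono) auto
    also have "\<dots> \<le> \<bar>M\<bar> * (G K * ?u n ^ 2) ^ e"
      using G[OF elim(2)] G_pos[of n] by (intro mult_left_mono power_mono) auto
    also have "\<dots> = (\<bar>M\<bar> * G K ^ e) * ?u n ^ (2 * e)" by (simp add: power_mult power_mult_distrib)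
    also have "\<dots> < ?u n ^ m * ?u n ^ (2 * e)"
    proof (intro mult_strict_right_mono)
      show "\<bar>M\<bar> * G K ^ e < ?u n ^ m"
        using m power_mono[OF u(2)[OF n], of m] by simp
    qed (use u(1)[OF n] in simp)
    finally have "M * G n ^ e * \<delta> (Suc n) < ?u n ^ (m + 2 * e) * \<delta> (Suc n)"
      using \<delta>(1)[of "Suc n"] by (intro mult_strict_right_mono) (auto simp: power_add)
    also have "\<dots> \<le> 1" using elim(1) by (simp add: mult.commute)
    finally show ?case .
  qed
qed

text \<open>In norms, k is the base p logarithm of |a| and h that of |a|/|b|. The claim splits along
  the maximum in \<delta>: the limit of k settles the entry 1, the limit of h the entry |b|.\<close>

lemma limits_imp_fast:
  assumes k: "(\<lambda>n. mcf_k \<alpha> \<beta> n / (mcf_k \<alpha> \<beta> (n - 1) + mcf_k \<alpha> \<beta> (n - 2))) \<longlonglongrightarrow> \<infinity>"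
    and h: "(\<lambda>n. mcf_h \<alpha> \<beta> n / mcf_k \<alpha> \<beta> (n - 1)) \<longlonglongrightarrow> \<infinity>"
  shows "\<forall>\<^sub>F n in sequentially. \<delta> (Suc n) * pnorm CARD('p) (a n) ^ T \<le> 1"
proof -
  let ?p = "real CARD('p)"
  define \<kappa> where "\<kappa> n = rat_val CARD('p) (1 / a n)" for n
  \<comment> \<open>An integer counterpart of h; where \<open>b n = 0\<close> it carries no
    information and is not consulted.\<close>
  define \<eta> where "\<eta> n = rat_val CARD('p) (b n / a n)" for n
  have p1: "?p > 1" using card_ge_3 by simp
  have a0: "a n \<noteq> 0" if "n \<ge> 1" for n using a_nonzero[of "n - 1"] that by simp
  have u: "pnorm CARD('p) (a n) = ?p powi \<kappa> n" if "n \<ge> 1" for n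
  proof -
    have "inverse (pnorm CARD('p) (a n)) = pnorm CARD('p) (1 / a n)"
      unfolding divide_inverse mult_1 by (rule pnorm_inverse[OF prime_card, symmetric])
    also have "\<dots> = inverse (?p powi \<kappa> n)"
      using a0[OF that] by (simp add: pnorm_def \<kappa>_def power_int_minus)
    finally show ?thesis by simp
  qed
  have \<kappa>: "\<kappa> n \<ge> 1" if "n \<ge> 1" for n
  proof (rule ccontr)
    assume "\<not> ?thesis"
    hence "?p powi \<kappa> n \<le> ?p powi 0" using p1 by (intro power_int_increasing) auto
    thus False using a_gt_1[of "n - 1"] u[OF that] that by simp
  qed
  have kval: "mcf_k \<alpha> \<beta> n = ereal (of_int (\<kappa> n))" if "n \<ge> 1" for n
    using a0[OF that] by (simp add: mcf_k_def padic_val_def \<kappa>_def)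
  have ev1: "\<forall>\<^sub>F n in sequentially. ereal (real T) < mcf_k \<alpha> \<beta> (Suc n) / (mcf_k \<alpha> \<beta> (Suc n - 1) + mcf_k \<alpha> \<beta> (Suc n - 2))"
    using k unfolding tendsto_PInfty by (subst eventually_sequentially_Suc) blast
  have ev2: "\<forall>\<^sub>F n in sequentially. ereal (real T) < mcf_h \<alpha> \<beta> (Suc n) / mcf_k \<alpha> \<beta> (Suc n - 1)"
    using h unfolding tendsto_PInfty by (subst eventually_sequentially_Suc) blast
  show ?thesis
    \<comment> \<open>At \<open>Suc n\<close> the quotients involve the indices n and n - 1; both
      must be at least 1 for \<kappa> to be positive.\<close>
    using ev1 ev2 eventually_ge_at_top[of 2]
  proof eventually_elim
    case (elim n)
    hence n: "n \<ge> 1" "n - 1 \<ge> 1" by simp_all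
    have uT: "pnorm CARD('p) (a n) ^ T = ?p powi (\<kappa> n * int T)"
      unfolding u[OF n(1)] by (simp add: power_int_mult)
    have "real T < real_of_int (\<kappa> (Suc n)) / (real_of_int (\<kappa> n) + real_of_int (\<kappa> (n - 1)))"
      using elim(1) n \<kappa>[OF n(1)] \<kappa>[OF n(2)] by (simp add: kval numeral_2_eq_2)
    hence "real T * (real_of_int (\<kappa> n) + real_of_int (\<kappa> (n - 1))) < real_of_int (\<kappa> (Suc n))"
      using \<kappa>[OF n(1)] \<kappa>[OF n(2)] by (simp add: field_simps)
    moreover have "real T * real_of_int (\<kappa> n) \<le> real T * (real_of_int (\<kappa> n) + real_of_int (\<kappa> (n - 1)))"
      using \<kappa>[OF n(2)] by (intro mult_left_mono) auto
    ultimately have "real_of_int (\<kappa> n * int T) \<le> real_of_int (\<kappa> (Suc n))" by (simp add: mult.commute)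
    hence "\<kappa> n * int T \<le> \<kappa> (Suc n)" by (simp only: of_int_le_iff)
    hence 1: "?p powi (\<kappa> n * int T) \<le> pnorm CARD('p) (a (Suc n))"
      using p1 by (subst u) (auto intro: power_int_increasing)
    have 2: "pnorm CARD('p) (b (Suc n)) * ?p powi (\<kappa> n * int T) \<le> pnorm CARD('p) (a (Suc n))"
    \<comment> \<open>For b = 0 the extended value h is infinite, and the bound is trivial.\<close>
    proof (cases "b (Suc n) = 0")
      case True
      thus ?thesis by (simp add: pnorm_0[OF prime_card] pnorm_nonneg[OF prime_card])
    next
      case False
      hence ba: "b (Suc n) / a (Suc n) \<noteq> 0" using a_nonzero[of n] by simp
      hence "mcf_h \<alpha> \<beta> (Suc n) = ereal (of_int (\<eta> (Suc n)))"
        by (simp add: mcf_h_def padic_val_def \<eta>_def)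
      hence "real T < real_of_int (\<eta> (Suc n)) / real_of_int (\<kappa> n)"
        using elim(2) n \<kappa>[OF n(1)] by (simp add: kval)
      hence "real_of_int (\<kappa> n * int T) \<le> real_of_int (\<eta> (Suc n))"
        using \<kappa>[OF n(1)] by (simp add: field_simps)
      hence le: "\<kappa> n * int T \<le> \<eta> (Suc n)" by (simp only: of_int_le_iff)
      have "pnorm CARD('p) (b (Suc n)) = pnorm CARD('p) (b (Suc n) / a (Suc n)) * pnorm CARD('p) (a (Suc n))"
        using a_nonzero[of n] by (simp flip: pnorm_mult[OF prime_card])
      also have "pnorm CARD('p) (b (Suc n) / a (Suc n)) = ?p powi (- \<eta> (Suc n))"
        using ba by (simp add: pnorm_def \<eta>_def)
      finally have "pnorm CARD('p) (b (Suc n)) * ?p powi (\<kappa> n * int T)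
          = ?p powi (\<kappa> n * int T - \<eta> (Suc n)) * pnorm CARD('p) (a (Suc n))"
        using p1 by (simp add: power_int_diff power_int_minus field_simps)
      also have "\<dots> \<le> ?p powi 0 * pnorm CARD('p) (a (Suc n))"
        using le p1 by (intro mult_right_mono power_int_increasing pnorm_nonneg[OF prime_card]) auto
      finally show ?thesis by simp
    qed
    have "max (pnorm CARD('p) (b (Suc n))) 1 * ?p powi (\<kappa> n * int T) \<le> pnorm CARD('p) (a (Suc n))"
      using 1 2 by (simp add: max_def)
    thus ?case unfolding uT \<delta>_def using a_gt_1[of n] by (simp add: field_simps)
  qed
qed

end

text \<open>Truncated subtraction in the indices and the values at index 0 affect only finitely many
  terms of the two limits. The polynomial obtained is any one that annihilates \<alpha>,
  \<beta>.\<close>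

theorem theorem23:
  fixes \<alpha> \<beta> :: "'p::prime_card padic"
  assumes "odd CARD('p)"
    and "infinite_mcf \<alpha> \<beta>"
    and "(\<lambda>n. mcf_k \<alpha> \<beta> n / (mcf_k \<alpha> \<beta> (n - 1) + mcf_k \<alpha> \<beta> (n - 2))) \<longlonglongrightarrow> \<infinity>"
    and "(\<lambda>n. mcf_h \<alpha> \<beta> n / mcf_k \<alpha> \<beta> (n - 1)) \<longlonglongrightarrow> \<infinity>"
  shows "alg_indep2 \<alpha> \<beta> \<or>
    (\<exists>F :: rat poly poly. F \<noteq> 0 \<and>
       (\<forall>\<^sub>F n in sequentially. eval2 F (Q_alpha \<alpha> \<beta> n) (Q_beta \<alpha> \<beta> n) = 0))"
proof (unfold disj_imp, rule impI)
  assume "\<not> alg_indep2 \<alpha> \<beta>"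
  then obtain F where F: "F \<noteq> 0" "eval2 F \<alpha> \<beta> = 0" unfolding alg_indep2_def by blast
  interpret padic_mcf \<alpha> \<beta> using assms(1,2) by unfold_locales
  obtain M e where M: "\<And>n. eval2 F (Q_alpha \<alpha> \<beta> n) (Q_beta \<alpha> \<beta> n) \<noteq> 0 \<Longrightarrow>
      1 \<le> M * G n ^ e * \<delta> (Suc n)"
    using eval2_convergents_lower_bound[OF F(2)] by blast
  have "\<forall>\<^sub>F n in sequentially. M * G n ^ e * \<delta> (Suc n) < 1"
    by (rule rapid_growth) (rule limits_imp_fast[OF assms(3,4)])
  hence "\<forall>\<^sub>F n in sequentially. eval2 F (Q_alpha \<alpha> \<beta> n) (Q_beta \<alpha> \<beta> n) = 0"
  proof eventually_elim
    case (elim n)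
    thus ?case using M[of n] by linarith
  qed
  with F(1) show "\<exists>F :: rat poly poly. F \<noteq> 0 \<and>
       (\<forall>\<^sub>F n in sequentially. eval2 F (Q_alpha \<alpha> \<beta> n) (Q_beta \<alpha> \<beta> n) = 0)" by blast
qed

end
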